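(* Let $X$ be a complete $\mathrm{CAT}(1)$ space such that $d(v,v')<\pi/2$ for every $v,v'\in X$. Let $C_1,C_2,\ldots,C_r$ be a finite number of closed convex subsets of $X$ such that $C:=\bigcap_{i=1}^rC_i\neq\emptyset$, and let $\alpha_{n,1},\alpha_{n,2},\ldots,\alpha_{n,r}$ be real numbers for $n\in\mathbb{N}$ such that $\alpha_{n,i}\in[a,1-a]$ for every $n\in\mathbb{N}$ and $i=1,2,\ldots,r$, where $0<a<1/2$. For $n\in\mathbb{N}$, let $W_n$ be the $W$-mapping of $X$ into itself generated by the metric projections $P_{C_1},P_{C_2},\ldots,P_{C_r}$ and $\alpha_{n,1},\alpha_{n,2},\ldots,\alpha_{n,r}$. Let $\{\beta_n\}$ be a sequence of real numbers such that $0<\beta_n<1$ for every $n\in\mathbb{N}$, $\lim_{n\to\infty}\beta_n=0$ and $\sum_{n=1}^\infty\beta_n=\infty$. For given points $u,x_1\in X$, let $\{x_n\}$ be the sequence in $X$ generated by \[ x_{n+1}=\beta_nu\oplus(1-\beta_n)W_nx_n \] for $n\in\mathbb{N}$. Suppose that one of the following conditions holds: (a) $\sup_{v,v'\in X}d(v,v')<\pi/2$; (b) $d(u,P_Cu)<\pi/4$ and $d(u,P_Cu)+d(x_1,P_Cu)<\pi/2$; (c) $\sum_{n=1}^\infty\beta_n^2=\infty$. Then $\{x_n\}$ converges (in the metric $d$) to $P_Cu$.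
   Context: Let $(X,d)$ be a metric space. A geodesic of $x,y\in X$ is a mapping $c:[0,l]\to X$ with $c(0)=x$, $c(l)=y$ and $d(c(s),c(t))=|s-t|$ for all $s,t\in[0,l]$. The space $X$ is always assumed to be $\pi$-geodesic (a geodesic of $x,y$ exists whenever $d(x,y)<\pi$) and every geodesic is assumed to be unique; $[x,y]:=c([0,l])$ is the geodesic segment. For $t\in[0,1]$, $tx\oplus(1-t)y:=c((1-t)l)$, where $c$ is the geodesic of $x,y$ and $l=d(x,y)$; i.e. it is the point $z\in[x,y]$ with $d(x,z)=(1-t)d(x,y)$. A subset $C$ is convex if $[x,y]\subset C$ for all $x,y\in C$. $\mathrm{CAT}(1)$ space: Let $\mathbb{S}^2$ be the unit sphere in $\mathbb{R}^3$ with spherical metric $d_{\mathbb{S}^2}$. For $x,y,z\in X$ with $d(x,y)+d(y,z)+d(z,x)<2\pi$ there are $\overline{x},\overline{y},\overline{z}\in\mathbb{S}^2$ with the same pairwise distances. For $p\in[x,y]$, a comparison point is $\overline{p}\in[\overline{x},\overline{y}]$ with $d_{\mathbb{S}^2}(\overline{x},\overline{p})=d(x,p)$ (similarly for the other sides). $X$ is a $\mathrm{CAT}(1)$ space if for every such triangle and all $p,q\in[x,y]\cup[y,z]\cup[z,x]$ with comparison points $\overline{p},\overline{q}$ one has $d(p,q)\le d_{\mathbb{S}^2}(\overline{p},\overline{q})$. Metric projection: if $X$ is a complete $\mathrm{CAT}(1)$ space with $d(v,v')<\pi/2$ for all $v,v'\in X$ and $C\subset X$ is nonempty, closed and convex,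 then for each $x\in X$ there is a unique point $P_Cx\in C$ with $d(x,P_Cx)=\inf_{y\in C}d(x,y)$; the mapping $P_C$ is the metric projection from $X$ onto $C$. $W$-mapping: for mappings $T_1,\ldots,T_r:X\to X$ and $\alpha_1,\ldots,\alpha_r\in[0,1]$, put $U_1:=\alpha_1T_1\oplus(1-\alpha_1)I$ and $U_k:=\alpha_kT_kU_{k-1}\oplus(1-\alpha_k)I$ for $k=2,\ldots,r$, where $I$ is the identity and these operations are pointwise (e.g. $U_kx=\alpha_kT_kU_{k-1}x\oplus(1-\alpha_k)x$). The $W$-mapping generated by $T_1,\ldots,T_r$ and $\alpha_1,\ldots,\alpha_r$ is $W:=U_r$. *)

theory Defs
  imports "HOL-Analysis.Analysis"
begin

text \<open>
  Geodesics are defined relative to a carrier \<open>S\<close> and a distance function \<open>d\<close>, so that the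
  same notion applies both to a metric space \<open>'a\<close> (with \<open>S = UNIV\<close> and \<open>d = dist\<close>) and to the
  unit sphere with its angular distance, which is not the \<open>dist\<close> of \<open>real ^ 3\<close>.
\<close>

definition geodesic_of ::
    "'a set \<Rightarrow> ('a \<Rightarrow> 'a \<Rightarrow> real) \<Rightarrow> 'a \<Rightarrow> 'a \<Rightarrow> (real \<Rightarrow> 'a) \<Rightarrow> real \<Rightarrow> bool" where
  "geodesic_of S d x y c l \<longleftrightarrow>
     0 \<le> l \<and> c ` {0..l} \<subseteq> S \<and> c 0 = x \<and> c l = y \<and>
     (\<forall>s\<in>{0..l}. \<forall>t\<in>{0..l}. d (c s) (c t) = \<bar>s - t\<bar>)"

text \<open>
  The union over all geodesics from \<open>x\<close> to \<open>y\<close>; when the geodesic is unique (the only case in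
  which this is used) it is the image of that geodesic.
\<close>

definition geodesic_segment ::
    "'a set \<Rightarrow> ('a \<Rightarrow> 'a \<Rightarrow> real) \<Rightarrow> 'a \<Rightarrow> 'a \<Rightarrow> 'a set" where
  "geodesic_segment S d x y = {p. \<exists>c l. geodesic_of S d x y c l \<and> p \<in> c ` {0..l}}"

abbreviation segm :: "'a::metric_space \<Rightarrow> 'a \<Rightarrow> 'a set" where
  "segm \<equiv> geodesic_segment UNIV dist"

definition unique_pi_geodesic :: "'a::metric_space itself \<Rightarrow> bool" where
  "unique_pi_geodesic _ \<longleftrightarrow>
     (\<forall>x y :: 'a. dist x y < pi \<longrightarrow> (\<exists>c l. geodesic_of UNIV dist x y c l)) \<and>
     (\<forall>(x::'a) y c l c' l'.
        geodesic_of UNIV dist x y c l \<and> geodesic_of UNIV dist x y c' l' \<longrightarrow>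
        l = l' \<and> (\<forall>t\<in>{0..l}. c t = c' t))"

abbreviation S2 :: "(real ^ 3) set" where
  "S2 \<equiv> sphere 0 1"

definition dist_S2 :: "real ^ 3 \<Rightarrow> real ^ 3 \<Rightarrow> real" where
  "dist_S2 x y = arccos (x \<bullet> y)"

definition side_comparison ::
    "'a::metric_space \<Rightarrow> 'a \<Rightarrow> real ^ 3 \<Rightarrow> real ^ 3 \<Rightarrow> 'a \<Rightarrow> real ^ 3 \<Rightarrow> bool" where
  "side_comparison x y x' y' p p' \<longleftrightarrow>
     p \<in> segm x y \<and> p' \<in> geodesic_segment S2 dist_S2 x' y' \<and> dist_S2 x' p' = dist x p"

definition comparison_point ::
    "'a::metric_space \<Rightarrow> 'a \<Rightarrow> 'a \<Rightarrow> real ^ 3 \<Rightarrow> real ^ 3 \<Rightarrow> real ^ 3 \<Rightarrow> 'a \<Rightarrow> real ^ 3 \<Rightarrow> bool" where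
  "comparison_point x y z x' y' z' p p' \<longleftrightarrow>
     side_comparison x y x' y' p p' \<or> side_comparison y z y' z' p p' \<or>
     side_comparison z x z' x' p p'"

text \<open>
  The comparison triangle is quantified universally: it exists whenever the perimeter is less
  than \<open>2 * pi\<close> and is unique up to an isometry of the sphere. All its sides are then shorter
  than \<open>pi\<close>, so they have unique geodesics.
\<close>

definition CAT1_space :: "'a::metric_space itself \<Rightarrow> bool" where
  "CAT1_space _ \<longleftrightarrow> unique_pi_geodesic TYPE('a) \<and>
     (\<forall>x y z :: 'a. dist x y + dist y z + dist z x < 2 * pi \<longrightarrow>
       (\<forall>x'\<in>S2. \<forall>y'\<in>S2. \<forall>z'\<in>S2.
          dist_S2 x' y' = dist x y \<and> dist_S2 y' z' = dist y z \<and> dist_S2 z' x' = dist z x \<longrightarrow>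
          (\<forall>p q p' q'.
             comparison_point x y z x' y' z' p p' \<and> comparison_point x y z x' y' z' q q' \<longrightarrow>
             dist p q \<le> dist_S2 p' q')))"

text \<open>
  The point \<open>t x \<oplus> (1 - t) y\<close>. The parameter is the weight of the \<^emph>\<open>first\<close> point, so
  \<open>geo_comb 1 x y = x\<close> and \<open>geo_comb 0 x y = y\<close>.
\<close>

definition geo_comb :: "real \<Rightarrow> 'a::metric_space \<Rightarrow> 'a \<Rightarrow> 'a" where
  "geo_comb t x y = (THE z. \<exists>c l. geodesic_of UNIV dist x y c l \<and> z = c ((1 - t) * l))"

definition geo_convex :: "'a::metric_space set \<Rightarrow> bool" where
  "geo_convex C \<longleftrightarrow> (\<forall>x\<in>C. \<forall>y\<in>C. segm x y \<subseteq> C)"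

definition metric_proj :: "'a::metric_space set \<Rightarrow> 'a \<Rightarrow> 'a" where
  "metric_proj C x = (THE p. p \<in> C \<and> dist x p = (INF y\<in>C. dist x y))"

text \<open>
  \<open>W_mapping T \<alpha> r\<close> is generated by \<open>T 1, \<dots>, T r\<close> and \<open>\<alpha> 1, \<dots>, \<alpha> r\<close>. Starting the recursion
  with \<open>U\<^sub>0 = I\<close> gives the required \<open>U\<^sub>1 = \<alpha>\<^sub>1 T\<^sub>1 \<oplus> (1 - \<alpha>\<^sub>1) I\<close>; the values \<open>T 0\<close> and \<open>\<alpha> 0\<close> are
  not used.
\<close>

primrec W_mapping :: "(nat \<Rightarrow> 'a \<Rightarrow> 'a) \<Rightarrow> (nat \<Rightarrow> real) \<Rightarrow> nat \<Rightarrow> 'a::metric_space \<Rightarrow> 'a" where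
  "W_mapping T \<alpha> 0 = (\<lambda>x. x)"
| "W_mapping T \<alpha> (Suc k) =
     (\<lambda>x. geo_comb (\<alpha> (Suc k)) (T (Suc k) (W_mapping T \<alpha> k x)) x)"

end

theory Submission
  imports Defs
begin

text \<open>
  Everything rests on one consequence of comparison with the sphere: for the point \<open>z\<close> that divides
  the segment from \<open>x\<close> to \<open>y\<close>, of length \<open>l\<close>, in the ratio given by \<open>t\<close>,
  \<open>cos (dist x w) * sin (t * l) + cos (dist y w) * sin ((1 - t) * l) \<le> cos (dist z w) * sin l\<close>
  for every \<open>w\<close> (\<open>cos_dist_geo_comb\<close>).

  Let \<open>p\<close> be the projection of \<open>u\<close> to the intersection, \<open>w n = W n (x n)\<close> and
  \<open>s n = 1 - cos (dist (x n) p)\<close>.  Applied to the segment from \<open>u\<close> to \<open>w n\<close>, the inequality bounds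
  \<open>s (Suc n)\<close> by a weighted mean of \<open>1 - cos (dist (w n) p)\<close> and a term that, for small \<open>\<beta> n\<close>, is
  about \<open>1 - cos (dist u p) / cos (dist u (w n))\<close> (\<open>halpern_step\<close>).  Projections, and therefore
  \<open>W n\<close>, do not increase the distance to \<open>p\<close>, so \<open>1 - cos (dist (w n) p) \<le> s n\<close>.

  Given \<open>e > 0\<close>, there are two kinds of late steps.  If this last inequality is almost an equality,
  then \<open>w n\<close> is nearly in each \<open>C i\<close> (\<open>W_mapping_gap\<close>), hence almost as far from \<open>u\<close> as \<open>p\<close> is, or
  farther (\<open>nearest_point_of_Inter\<close>), and the second term of the mean is at most \<open>e\<close>.  If it
  is strict by a fixed amount, then \<open>s\<close> decreases by a fixed amount, since the weights tend to
  \<open>0\<close>.  In both cases \<open>s (Suc n) - e \<le> (1 - g n) * (s n - e)\<close>, and the weights \<open>g n\<close> have divergent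
  sum, so that \<open>s n\<close> is eventually below \<open>2 * e\<close> (\<open>eventually_below_if_contracting\<close>).

  Approximate membership in the sets takes the place of weak (Delta-) convergence: instead of
  extracting a weakly convergent subsequence of \<open>w n\<close> whose limit lies in the intersection,
  one compares \<open>dist u (w n)\<close> directly with the distance from \<open>u\<close> to the points that are nearly
  in all sets.
\<close>

section \<open>Spherical trigonometry\<close>

lemma sin_concave_scale:
  assumes "0 \<le> t" "t \<le> 1" "0 \<le> D" "D \<le> pi"
  shows "t * sin D \<le> sin (t * D)"
proof -
  have "concave_on {0..pi} sin"
  proof (rule f''_le0_imp_concave)
    show "(sin has_real_derivative cos x) (at x)"
      and "(cos has_real_derivative - sin x) (at x)" for x :: real
      by (auto intro!: derivative_eq_intros)
  qed (auto intro: sin_ge_zero)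
  from concave_onD[OF this, of t 0 D] show ?thesis
    using assms by simp
qed

lemma cos_lipschitz: "\<bar>cos x - cos y\<bar> \<le> \<bar>x - y\<bar>" for x y :: real
proof -
  have "\<bar>cos x - cos y\<bar> = 2 * \<bar>sin ((x + y) / 2)\<bar> * \<bar>sin ((y - x) / 2)\<bar>"
    by (simp add: cos_diff_cos abs_mult)
  also have "\<dots> \<le> 2 * 1 * \<bar>(y - x) / 2\<bar>"
    by (intro mult_mono abs_sin_x_le_abs_x) (auto)
  finally show ?thesis by simp
qed

text \<open>
  The arc-length parametrisation of the great circle arc from \<open>x\<close> to \<open>y\<close>, where \<open>l\<close> is the
  angle between the two unit vectors.
\<close>

definition great_arc :: "real ^ 3 \<Rightarrow> real ^ 3 \<Rightarrow> real \<Rightarrow> real \<Rightarrow> real ^ 3" where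
  "great_arc x y l s = (sin (l - s) / sin l) *\<^sub>R x + (sin s / sin l) *\<^sub>R y"

lemma geodesic_great_arc:
  assumes "x \<in> S2" "y \<in> S2" "dist_S2 x y = l" "0 < l" "l < pi"
  shows "geodesic_of S2 dist_S2 x y (great_arc x y l) l"
proof -
  have xx: "x \<bullet> x = 1" and yy: "y \<bullet> y = 1"
    using assms(1,2) by (simp_all add: dot_square_norm)
  have "\<bar>x \<bullet> y\<bar> \<le> 1"
    using Cauchy_Schwarz_ineq2[of x y] assms(1,2) by simp
  then have xy: "x \<bullet> y = cos l"
    using assms(3) by (auto simp: dist_S2_def cos_arccos_abs)
  have sl: "sin l > 0" using assms by (simp add: sin_gt_zero)
  have inn: "great_arc x y l s \<bullet> great_arc x y l t = cos (s - t)" for s t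
  proof -
    have "great_arc x y l s \<bullet> great_arc x y l t =
      (sin (l - s) * sin (l - t) + (sin (l - s) * sin t + sin s * sin (l - t)) * cos l
        + sin s * sin t) / (sin l)\<^sup>2"
      using sl xx yy xy
      by (simp add: great_arc_def inner_add_left inner_add_right inner_commute[of y x]
          field_simps power2_eq_square)
    also have "sin (l - s) * sin (l - t) + (sin (l - s) * sin t + sin s * sin (l - t)) * cos l
        + sin s * sin t = cos (s - t) * (sin l)\<^sup>2"
      using sin_cos_squared_add[of l] sin_cos_squared_add[of s] sin_cos_squared_add[of t]
      unfolding sin_diff cos_diff by algebra
    finally show ?thesis using sl by simp
  qed
  have "great_arc x y l s \<in> S2" for s
    using inn[of s s] by (simp add: norm_eq_1)
  moreover have "dist_S2 (great_arc x y l s) (great_arc x y l t) = \<bar>s - t\<bar>"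
    if "s \<in> {0..l}" "t \<in> {0..l}" for s t
  proof -
    have "dist_S2 (great_arc x y l s) (great_arc x y l t) = arccos (cos \<bar>s - t\<bar>)"
      by (simp add: dist_S2_def inn)
    also have "\<dots> = \<bar>s - t\<bar>"
      by (rule arccos_cos) (use that assms in auto)
    finally show ?thesis .
  qed
  ultimately show ?thesis
    using sl assms by (auto simp: geodesic_of_def great_arc_def)
qed

lemma sphere_geodesic_exists:
  assumes "x \<in> S2" "y \<in> S2" "dist_S2 x y < pi"
  shows "\<exists>c. geodesic_of S2 dist_S2 x y c (dist_S2 x y)"
proof (cases "dist_S2 x y = 0")
  case True
  have n: "norm x = 1" "norm y = 1" using assms by auto
  have "\<bar>x \<bullet> y\<bar> \<le> 1"
    using Cauchy_Schwarz_ineq2[of x y] assms(1,2) by simp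
  then have "x \<bullet> y = 1"
    using True by (metis dist_S2_def cos_arccos_abs cos_zero)
  then have "x = y"
    using n by (metis norm_cauchy_schwarz_eq scaleR_one mult_1)
  then show ?thesis
    using True assms n by (intro exI[of _ "\<lambda>_. x"]) (auto simp: geodesic_of_def)
next
  case False
  have "0 \<le> dist_S2 x y"
    using Cauchy_Schwarz_ineq2[of x y] assms(1,2)
    by (auto simp: dist_S2_def intro!: arccos_lbound)
  then show ?thesis using geodesic_great_arc[OF assms(1,2) refl] False assms(3) by force
qed

text \<open>
  Placing \<open>x\<close> and \<open>y\<close> on the equator fixes the first two coordinates of \<open>w\<close> through the
  required inner products.  The third one exists because the triangle inequalities, read through
  the addition formulas of the cosine, say exactly that those two coordinates have square sum at
  most one.
\<close>

lemma comparison_triangle_exists: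
  fixes l b c :: real
  assumes "0 < l" "l < pi / 2" "0 \<le> b" "b < pi / 2" "0 \<le> c" "c < pi / 2"
    and tri: "l \<le> b + c" "b \<le> c + l" "c \<le> l + b"
  shows "\<exists>x\<in>S2. \<exists>y\<in>S2. \<exists>w\<in>S2. dist_S2 x y = l \<and> dist_S2 y w = c \<and> dist_S2 w x = b"
proof -
  define h where "h = (cos c - cos b * cos l) / sin l"
  have sl: "sin l > 0" using assms by (simp add: sin_gt_zero)
  have sb: "sin b \<ge> 0" using assms by (simp add: sin_ge_zero)
  have "cos (b + l) \<le> cos c"
    by (rule cos_monotone_0_pi_le) (use assms in auto)
  moreover have "cos c \<le> cos \<bar>b - l\<bar>"
    by (rule cos_monotone_0_pi_le) (use assms in auto)
  ultimately have "\<bar>cos c - cos b * cos l\<bar> \<le> sin b * sin l"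
    by (auto simp: cos_add cos_diff)
  then have "\<bar>h\<bar> \<le> sin b"
    using sl by (simp add: h_def abs_divide divide_le_eq)
  then have "h\<^sup>2 \<le> (sin b)\<^sup>2"
    using sb by (metis abs_le_square_iff abs_of_nonneg)
  then have r: "(sqrt ((sin b)\<^sup>2 - h\<^sup>2))\<^sup>2 = (sin b)\<^sup>2 - h\<^sup>2" by simp
  define x y w :: "real ^ 3" where "x = vector [1, 0, 0]" and "y = vector [cos l, sin l, 0]"
    and "w = vector [cos b, h, sqrt ((sin b)\<^sup>2 - h\<^sup>2)]"
  have "x \<bullet> x = 1" "y \<bullet> y = 1" "x \<bullet> y = cos l" "w \<bullet> x = cos b"
    by (simp_all add: x_def y_def w_def inner_vec_def sum_3 flip: power2_eq_square)
  moreover have "w \<bullet> w = 1"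
    using r by (simp add: w_def inner_vec_def sum_3 flip: power2_eq_square)
  moreover have "y \<bullet> w = cos c"
    using sl by (simp add: y_def w_def inner_vec_def sum_3 h_def)
  moreover have "arccos (cos l) = l" "arccos (cos b) = b" "arccos (cos c) = c"
    using assms by (auto intro!: arccos_cos)
  ultimately show ?thesis
    by (intro bexI[of _ x] bexI[of _ y] bexI[of _ w]) (auto simp: dist_S2_def norm_eq_1)
qed

section \<open>The comparison inequality\<close>

text \<open>
  Every triangle in such a space has perimeter below \<open>3 * pi / 2\<close>, so comparison is always
  available, and all cosines of distances are positive.  The type argument names the space.
\<close>

locale small_CAT1 =
  fixes space_type :: "'a::complete_space itself"
  assumes cat1: "CAT1_space TYPE('a)"
    and small: "\<And>v v' :: 'a. dist v v' < pi / 2"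
begin

lemma dist_less_pi: "dist v w < pi" for v w :: 'a
  using small[of v w] pi_gt_zero by linarith

lemma geodesic_exists: "\<exists>c. geodesic_of UNIV dist x y c (dist x y)" for x y :: 'a
proof -
  obtain c l where c: "geodesic_of UNIV dist x y c l"
    using cat1 dist_less_pi[of x y] unfolding CAT1_space_def unique_pi_geodesic_def by blast
  moreover have "l = dist x y"
  proof -
    have "0 \<in> {0..l}" "l \<in> {0..l}" using c by (auto simp: geodesic_of_def)
    then have "dist (c 0) (c l) = \<bar>0 - l\<bar>" using c unfolding geodesic_of_def by blast
    then show ?thesis using c by (simp add: geodesic_of_def)
  qed
  ultimately show ?thesis by blast
qed

lemma geo_comb_eq:
  fixes x y :: 'a
  assumes c: "geodesic_of UNIV dist x y c l" and "0 \<le> t" "t \<le> 1"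
  shows "geo_comb t x y = c ((1 - t) * l)"
  unfolding geo_comb_def
proof (rule the_equality)
  fix z assume "\<exists>c l. geodesic_of UNIV dist x y c l \<and> z = c ((1 - t) * l)"
  then obtain c' l' where c': "geodesic_of UNIV dist x y c' l'" and z: "z = c' ((1 - t) * l')"
    by blast
  have "l = l' \<and> (\<forall>t\<in>{0..l}. c t = c' t)"
    using cat1 c c' unfolding CAT1_space_def unique_pi_geodesic_def by blast
  moreover have "(1 - t) * l \<in> {0..l}"
    using assms by (auto simp: geodesic_of_def mult_left_le_one_le)
  ultimately show "z = c ((1 - t) * l)" using z by metis
qed (use c in blast)

lemma
  fixes x y :: 'a
  assumes t: "0 \<le> t" "t \<le> 1"
  shows geo_comb_in_segm: "geo_comb t x y \<in> segm x y"
    and dist_left_geo_comb: "dist x (geo_comb t x y) = (1 - t) * dist x y"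
    and dist_geo_comb_right: "dist (geo_comb t x y) y = t * dist x y"
proof -
  define l where "l = dist x y"
  obtain c where c: "geodesic_of UNIV dist x y c l"
    using geodesic_exists l_def by blast
  have z: "geo_comb t x y = c ((1 - t) * l)" by (rule geo_comb_eq[OF c t])
  have m: "(1 - t) * l \<in> {0..l}"
    using t by (auto simp: l_def mult_left_le_one_le)
  show "geo_comb t x y \<in> segm x y"
    unfolding geodesic_segment_def z using c m by blast
  have "0 \<in> {0..l}" "l \<in> {0..l}" by (auto simp: l_def)
  then have "dist (c 0) (c ((1 - t) * l)) = \<bar>0 - (1 - t) * l\<bar>"
    and "dist (c ((1 - t) * l)) (c l) = \<bar>(1 - t) * l - l\<bar>"
    using c m unfolding geodesic_of_def by blast+
  moreover have "\<bar>0 - (1 - t) * l\<bar> = (1 - t) * l" using m by simp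
  moreover have "\<bar>(1 - t) * l - l\<bar> = t * l" using m by (simp add: algebra_simps)
  moreover have "c 0 = x" "c l = y" using c by (simp_all add: geodesic_of_def)
  ultimately show "dist x (geo_comb t x y) = (1 - t) * dist x y"
    and "dist (geo_comb t x y) y = t * dist x y"
    unfolding z l_def by simp_all
qed

lemma geo_comb_in_convex:
  "geo_convex K \<Longrightarrow> x \<in> K \<Longrightarrow> y \<in> K \<Longrightarrow> 0 \<le> t \<Longrightarrow> t \<le> 1 \<Longrightarrow> geo_comb t x y \<in> K"
  for K :: "'a set"
  using geo_comb_in_segm unfolding geo_convex_def by blast

lemma cos_dist_pos: "0 < cos (dist x y)" for x y :: 'a
  by (rule cos_gt_zero_pi) (use small[of x y] zero_le_dist[of x y] pi_gt_zero in linarith)+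

text \<open>
  On the sphere this is an equality, because the point that divides an arc of length \<open>l\<close> is the
  combination of the end points with coefficients \<open>sin (t * l) / sin l\<close> and
  \<open>sin ((1 - t) * l) / sin l\<close>, and the inner product is linear.  Comparison of the dividing point
  with the opposite vertex turns it into an inequality.  This is the form in which curvature enters
  all later estimates.
\<close>

lemma cos_dist_geo_comb:
  fixes x y w :: 'a
  assumes t: "0 \<le> t" "t \<le> 1"
  shows "cos (dist x w) * sin (t * dist x y) + cos (dist y w) * sin ((1 - t) * dist x y)
    \<le> cos (dist (geo_comb t x y) w) * sin (dist x y)"
proof (cases "x = y")
  case False
  define l b c z where "l = dist x y" and "b = dist w x" and "c = dist y w"
    and "z = geo_comb t x y"
  have l: "0 < l" "l < pi / 2" using False small by (auto simp: l_def)
  have m: "0 \<le> (1 - t) * l" "(1 - t) * l \<le> l"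
    using t l by (auto simp: mult_left_le_one_le)
  have "b < pi / 2" "c < pi / 2" "0 \<le> b" "0 \<le> c"
    using small by (auto simp: b_def c_def)
  moreover have "l \<le> b + c" "b \<le> c + l" "c \<le> l + b"
    unfolding l_def b_def c_def by metric+
  ultimately obtain x' y' w' where S: "x' \<in> S2" "y' \<in> S2" "w' \<in> S2"
    and d: "dist_S2 x' y' = l" "dist_S2 y' w' = c" "dist_S2 w' x' = b"
    using comparison_triangle_exists[of l b c] l by blast
  have peri: "dist x y + dist y w + dist w x < 2 * pi"
    using small[of x y] small[of y w] small[of w x] pi_gt_zero by linarith
  define z' where "z' = great_arc x' y' l ((1 - t) * l)"
  have g: "geodesic_of S2 dist_S2 x' y' (great_arc x' y' l) l"
    using geodesic_great_arc S d l by simp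
  have z'S: "z' \<in> S2" and "dist_S2 x' z' = (1 - t) * l"
    and seg: "z' \<in> geodesic_segment S2 dist_S2 x' y'"
  proof -
    have "(1 - t) * l \<in> {0..l}" "0 \<in> {0..l}" using m l by auto
    then have "great_arc x' y' l ((1 - t) * l) \<in> great_arc x' y' l ` {0..l}"
      and "dist_S2 (great_arc x' y' l 0) (great_arc x' y' l ((1 - t) * l)) = \<bar>0 - (1 - t) * l\<bar>"
      using g unfolding geodesic_of_def by blast+
    moreover have "great_arc x' y' l ` {0..l} \<subseteq> S2" "great_arc x' y' l 0 = x'"
      using g by (simp_all add: geodesic_of_def)
    ultimately show "z' \<in> S2" "z' \<in> geodesic_segment S2 dist_S2 x' y'"
      "dist_S2 x' z' = (1 - t) * l"
      using g m unfolding z'_def geodesic_segment_def by (blast, blast, simp)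
  qed
  then have "side_comparison x y x' y' z z'"
    using dist_left_geo_comb geo_comb_in_segm t by (simp add: side_comparison_def z_def l_def)
  then have "comparison_point x y w x' y' w' z z'" by (simp add: comparison_point_def)
  moreover have "comparison_point x y w x' y' w' w w'"
  proof -
    have "b < pi" using dist_less_pi unfolding b_def .
    then obtain c' where "geodesic_of S2 dist_S2 w' x' c' b"
      using sphere_geodesic_exists S d by metis
    moreover from this have "w' = c' 0" "0 \<in> {0..b}" by (auto simp: geodesic_of_def)
    ultimately have "w' \<in> geodesic_segment S2 dist_S2 w' x'"
      unfolding geodesic_segment_def by blast
    moreover have "w \<in> segm w x"
      using geo_comb_in_segm[of 1 w x] dist_left_geo_comb[of 1 w x] by simp
    moreover have "dist_S2 w' w' = dist w w"
      using S by (simp add: dist_S2_def norm_eq_1)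
    ultimately show ?thesis by (simp add: comparison_point_def side_comparison_def)
  qed
  ultimately have le: "dist z w \<le> dist_S2 z' w'"
    using cat1 peri S d unfolding CAT1_space_def l_def b_def c_def by blast
  have ab: "\<bar>p \<bullet> q\<bar> \<le> 1" if "p \<in> S2" "q \<in> S2" for p q
    using Cauchy_Schwarz_ineq2[of p q] that by simp
  then have inn: "p \<bullet> q = cos (dist_S2 p q)" if "p \<in> S2" "q \<in> S2" for p q
    using that by (simp add: dist_S2_def cos_arccos_abs)
  have "z' \<bullet> w' \<le> cos (dist z w)"
    unfolding inn[OF z'S S(3)]
  proof (rule cos_monotone_0_pi_le[OF _ le])
    show "dist_S2 z' w' \<le> pi"
      using ab[OF z'S S(3)] by (auto simp: dist_S2_def intro!: arccos_ubound)
  qed simp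
  moreover have "z' \<bullet> w' * sin l = cos b * sin (t * l) + cos c * sin ((1 - t) * l)"
  proof -
    have "sin l \<noteq> 0" using l sin_gt_zero[of l] by linarith
    moreover have "l - (1 - t) * l = t * l" by (simp add: algebra_simps)
    ultimately show ?thesis
      using inn[OF S(3) S(1)] inn[OF S(2) S(3)] d
      by (simp add: z'_def great_arc_def inner_add_left inner_commute[of x' w'] field_simps)
  qed
  moreover have "0 \<le> sin l" using l by (simp add: sin_ge_zero)
  ultimately show ?thesis
    unfolding l_def b_def c_def z_def
    using mult_right_mono[of "z' \<bullet> w'" "cos (dist (geo_comb t x y) w)" "sin (dist x y)"]
    by (simp add: dist_commute)
qed simp

abbreviation mid :: "'a \<Rightarrow> 'a \<Rightarrow> 'a" where "mid \<equiv> geo_comb (1 / 2)"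

text \<open>
  The spherical parallelogram inequality: dividing the previous lemma at \<open>t = 1 / 2\<close> by
  \<open>sin (l / 2)\<close> leaves the factor \<open>2 * cos (l / 2)\<close>, which is below \<open>2\<close> for distinct end points.
  That is the uniform convexity used for nearest points.
\<close>

lemma cos_dist_mid:
  "cos (dist x w) + cos (dist y w) \<le> 2 * cos (dist x y / 2) * cos (dist (mid x y) w)" for x y w :: 'a
proof (cases "x = y")
  case True
  then have "mid x y = x" using dist_left_geo_comb[of "1/2" x x] by simp
  then show ?thesis using True by simp
next
  case False
  define l where "l = dist x y"
  have "0 < l" "l < pi / 2" using False small by (auto simp: l_def)
  then have s: "0 < sin (l / 2)" by (simp add: sin_gt_zero)
  have "(cos (dist x w) + cos (dist y w)) * sin (l / 2) \<le> cos (dist (mid x y) w) * sin (2 * (l / 2))"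
    using cos_dist_geo_comb[of "1/2" x w y] by (simp add: l_def algebra_simps)
  also have "\<dots> = (2 * cos (l / 2) * cos (dist (mid x y) w)) * sin (l / 2)"
    unfolding sin_double by simp
  finally show ?thesis using s unfolding l_def by simp
qed

end

section \<open>Nearest points of intersections of convex sets\<close>

text \<open>
  The points that are approximately in every \<open>K i\<close>.  Witnesses replace the distance to the set,
  so that no nearest point needs to exist and no infimum has to be taken.
\<close>

definition near_all :: "('i \<Rightarrow> 'a::metric_space set) \<Rightarrow> 'i set \<Rightarrow> real \<Rightarrow> 'a set" where
  "near_all K I e = {y. \<forall>i\<in>I. \<exists>q\<in>K i. dist y q \<le> e}"

lemma near_all_mono: "e \<le> e' \<Longrightarrow> near_all K I e \<subseteq> near_all K I e'"
  unfolding near_all_def by force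

context small_CAT1
begin

text \<open>
  Midpoints depend on their end points in a uniformly continuous way.  Applying the midpoint
  inequality first along \<open>x' y'\<close> and then along \<open>x y\<close> bounds the cosine of the distance of the
  midpoints from below by the four cosines between the end points; as \<open>e\<close> tends to \<open>0\<close> the bound
  becomes \<open>(2 + 2 * cos l) / (4 * (cos (l / 2))\<^sup>2) = 1\<close>.
\<close>

lemma dist_mid_mid_le:
  fixes x y x' y' :: 'a
  assumes "dist x x' \<le> e" "dist y y' \<le> e"
  shows "1 - cos (dist (mid x y) (mid x' y')) \<le> 8 * e"
proof -
  define l l' k X where "l = dist x y" and "l' = dist x' y'" and "k = cos (l / 2)"
    and "X = cos (dist (mid x y) (mid x' y'))"
  have e: "0 \<le> e" using assms(1) zero_le_dist order_trans by blast
  have X: "0 < X" "X \<le> 1" using cos_dist_pos by (auto simp: X_def)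
  have "0 \<le> l / 2" "l / 2 \<le> pi / 3" "pi / 3 \<le> pi"
    using small[of x y] zero_le_dist[of x y] pi_gt_zero unfolding l_def by linarith+
  then have "cos (pi / 3) \<le> k"
    unfolding k_def by (rule cos_monotone_0_pi_le)
  then have k: "1 / 2 \<le> k" "k \<le> 1" by (auto simp: cos_60 k_def)
  have lip: "cos s - \<bar>t - s\<bar> \<le> cos t" for s t :: real
    using cos_lipschitz[of s t] by linarith
  have l': "\<bar>l' - l\<bar> \<le> 2 * e"
    using assms unfolding l_def l'_def by (auto simp: abs_le_iff) (metric+)
  have k': "cos (l' / 2) \<le> k + e"
    using lip[of "l' / 2" "l / 2"] l' by (auto simp: k_def)
  have l'0: "0 \<le> cos (l' / 2)"
    using small[of x' y'] zero_le_dist[of x' y'] pi_gt_zero unfolding l'_def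
    by (intro cos_ge_zero) linarith+
  \<comment> \<open>The four distances from \<open>x\<close>, \<open>y\<close> to \<open>x'\<close>, \<open>y'\<close> are within \<open>e\<close> of \<open>0\<close>, \<open>l\<close>, \<open>l\<close>, \<open>0\<close>.\<close>
  have far: "cos l - e \<le> cos (dist p q')"
    if "\<bar>dist p q' - l\<bar> \<le> e" for p q' :: 'a
    using lip[of l "dist p q'"] that by linarith
  have near: "1 - e \<le> cos (dist p q)" if "dist p q \<le> e" for p q :: 'a
    using lip[of 0 "dist p q"] that by simp
  have "cos l - e \<le> cos (dist x y')"
    by (rule far) (use assms in \<open>auto simp: abs_le_iff l_def; metric\<close>)
  moreover have "cos l - e \<le> cos (dist y x')"
    by (rule far) (use assms in \<open>auto simp: abs_le_iff l_def; metric\<close>)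
  moreover have "1 - e \<le> cos (dist x x')" "1 - e \<le> cos (dist y y')"
    using near assms by auto
  ultimately have "2 + 2 * cos l - 4 * e \<le>
      (cos (dist x x') + cos (dist x y')) + (cos (dist y x') + cos (dist y y'))"
    by linarith
  also have "\<dots> \<le> 2 * cos (l' / 2) * cos (dist x (mid x' y'))
      + 2 * cos (l' / 2) * cos (dist y (mid x' y'))"
    using cos_dist_mid[of x' x y'] cos_dist_mid[of x' y y'] unfolding l'_def
    by (simp add: dist_commute)
  also have "\<dots> = 2 * cos (l' / 2) * (cos (dist x (mid x' y')) + cos (dist y (mid x' y')))"
    by (simp add: algebra_simps)
  also have "\<dots> \<le> 2 * (k + e) * (2 * k * X)"
    using cos_dist_mid[of x "mid x' y'" y] k' l'0 k X e cos_dist_pos[of x "mid x' y'"]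
      cos_dist_pos[of y "mid x' y'"]
    unfolding l_def[symmetric] k_def[symmetric] X_def[symmetric]
    by (intro mult_mono) auto
  also have "\<dots> = 4 * k\<^sup>2 * X + 4 * e * (k * X)" by (simp add: algebra_simps power2_eq_square)
  also have "\<dots> \<le> 4 * k\<^sup>2 * X + 4 * e * 1"
    using k X e by (intro add_left_mono mult_left_mono) (auto intro: mult_le_one)
  finally have "2 + 2 * cos l \<le> 4 * k\<^sup>2 * X + 8 * e" by simp
  moreover have "2 + 2 * cos l = 4 * k\<^sup>2"
    using cos_double_cos[of "l / 2"] by (simp add: k_def)
  ultimately have le: "4 * k\<^sup>2 * (1 - X) \<le> 8 * e" by (simp add: algebra_simps)
  have "1 * (1 - X) \<le> 4 * k\<^sup>2 * (1 - X)"
  proof (rule mult_right_mono)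
    have "(1 / 2)\<^sup>2 \<le> k\<^sup>2" using k by (intro power_mono) auto
    then show "1 \<le> 4 * k\<^sup>2" by (simp add: power2_eq_square)
  qed (use X in simp)
  from order_trans[OF this le] show ?thesis unfolding X_def by simp
qed

lemma dist_less_if_cos:
  fixes v w :: 'a
  assumes "0 < e" "e \<le> pi" "cos e < cos (dist v w)"
  shows "dist v w < e"
  by (rule ccontr) (use assms cos_monotone_0_pi_le[of e "dist v w"] small[of v w] in auto)

text \<open>
  Approximate membership in convex sets survives midpoints with a loss that depends neither on the
  sets nor on the points: the midpoint of witnesses is a witness for the midpoint.
\<close>

lemma mid_in_near_all:
  assumes "0 < d"
  obtains e where "0 < e"
    "\<And>K :: 'i \<Rightarrow> 'a set. \<And>I y y'. (\<And>i. i \<in> I \<Longrightarrow> geo_convex (K i)) \<Longrightarrow>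
      y \<in> near_all K I e \<Longrightarrow> y' \<in> near_all K I e \<Longrightarrow> mid y y' \<in> near_all K I d"
proof -
  define d' where "d' = min d 1"
  have d': "0 < d'" "d' \<le> pi" "d' \<le> d" using assms pi_gt3 by (auto simp: d'_def)
  define e where "e = (1 - cos d') / 16"
  have "cos d' < cos 0" using d' by (intro cos_monotone_0_pi) auto
  then have e: "0 < e" by (simp add: e_def)
  show thesis
  proof (rule that[OF e])
    fix K :: "'i \<Rightarrow> 'a set" and I y y'
    assume K: "\<And>i. i \<in> I \<Longrightarrow> geo_convex (K i)"
      and y: "y \<in> near_all K I e" and y': "y' \<in> near_all K I e"
    have "\<exists>q\<in>K i. dist (mid y y') q \<le> d" if i: "i \<in> I" for i
    proof -
      obtain q q' where q: "q \<in> K i" "dist y q \<le> e" "q' \<in> K i" "dist y' q' \<le> e"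
        using y y' i unfolding near_all_def by blast
      have "dist (mid y y') (mid q q') < d'"
        by (rule dist_less_if_cos)
          (use d' e dist_mid_mid_le[OF q(2) q(4)] in \<open>auto simp: e_def\<close>)
      moreover have "mid q q' \<in> K i" using geo_comb_in_convex[OF K[OF i] q(1) q(3)] by simp
      ultimately show ?thesis using d' by force
    qed
    then show "mid y y' \<in> near_all K I d" by (simp add: near_all_def)
  qed
qed

text \<open>
  The third conclusion replaces weak compactness: a point that is nearly in every \<open>K i\<close>
  cannot be much closer to \<open>u\<close> than the intersection is.  (It may well be far from
  the intersection.)

  Let \<open>\<rho>\<close> be the limit, as \<open>e\<close> decreases to \<open>0\<close>, of the distance from \<open>u\<close> to
  \<open>near_all K I e\<close>.  Two points of \<open>near_all K I e\<close> at distance about \<open>\<rho>\<close> from \<open>u\<close> must be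
  close to each other: their midpoint is nearly in all sets, hence not much closer to \<open>u\<close> than \<open>\<rho>\<close>,
  and the midpoint inequality leaves no room for this when they are far apart.  So almost minimal
  points form a Cauchy sequence, and its limit \<open>q\<close> lies in the intersection and has distance
  exactly \<open>\<rho>\<close>.
\<close>

lemma nearest_point_of_Inter:
  fixes K :: "'i \<Rightarrow> 'a set" and u :: 'a
  assumes K: "\<And>i. i \<in> I \<Longrightarrow> closed (K i) \<and> geo_convex (K i)"
    and ne: "(\<Inter>i\<in>I. K i) \<noteq> {}"
  obtains q where "q \<in> (\<Inter>i\<in>I. K i)" "\<And>p. p \<in> (\<Inter>i\<in>I. K i) \<Longrightarrow> dist u q \<le> dist u p"
    "\<And>h. 0 < h \<Longrightarrow> \<exists>e>0. \<forall>y\<in>near_all K I e. dist u q - h \<le> dist u y"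
proof -
  \<comment> \<open>\<open>\<rho>\<close> is taken as the supremum of the lower bounds that hold on some \<open>near_all K I e\<close>.\<close>
  define R where "R = {t. \<exists>e>0. \<forall>y\<in>near_all K I e. t \<le> dist u y}"
  define \<rho> where "\<rho> = Sup R"
  have in_near: "p \<in> near_all K I e" if "p \<in> (\<Inter>i\<in>I. K i)" "0 < e" for p e
    unfolding near_all_def using that by (auto intro!: bexI[of _ p])
  have ub: "t \<le> dist u p" if "p \<in> (\<Inter>i\<in>I. K i)" "t \<in> R" for p t
    using that in_near unfolding R_def by blast
  have R0: "0 \<in> R" unfolding R_def by (auto intro: exI[of _ 1])
  obtain p0 where p0: "p0 \<in> (\<Inter>i\<in>I. K i)" using ne by blast
  have bdd: "bdd_above R" using ub[OF p0] by (rule bdd_aboveI)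
  have \<rho>_le: "\<rho> \<le> dist u p" if "p \<in> (\<Inter>i\<in>I. K i)" for p
    unfolding \<rho>_def using R0 ub[OF that] by (intro cSup_least) auto
  have \<rho>: "0 \<le> \<rho>" "\<rho> < pi / 2"
    using cSup_upper[OF R0 bdd] \<rho>_le[OF p0] small[of u p0] by (auto simp: \<rho>_def)
  have low: "\<exists>e>0. \<forall>y\<in>near_all K I e. \<rho> - h \<le> dist u y" if h: "0 < h" for h
  proof -
    have "\<rho> - h < Sup R" using h by (simp add: \<rho>_def)
    then obtain t where "t \<in> R" "\<rho> - h < t" using less_cSup_iff[OF _ bdd] R0 by blast
    then show ?thesis unfolding R_def by force
  qed
  have high: "\<exists>y\<in>near_all K I e. dist u y < \<rho> + h" if "0 < e" "0 < h" for e h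
  proof (rule ccontr)
    assume "\<not> ?thesis"
    then have "\<rho> + h \<in> R" using that unfolding R_def by force
    then show False using cSup_upper[OF _ bdd, of "\<rho> + h"] that by (simp add: \<rho>_def)
  qed
  have close: "\<exists>e>0. \<forall>y\<in>near_all K I e. \<forall>y'\<in>near_all K I e.
      dist u y \<le> \<rho> + e \<longrightarrow> dist u y' \<le> \<rho> + e \<longrightarrow> dist y y' < \<tau>" if \<tau>: "0 < \<tau>" for \<tau>
  proof -
    \<comment> \<open>Truncation keeps \<open>\<sigma>\<close> in the range where the cosine decreases.\<close>
    define \<sigma> where "\<sigma> = min \<tau> 1"
    have \<sigma>: "0 < \<sigma>" "\<sigma> \<le> pi" "\<sigma> \<le> \<tau>" using \<tau> pi_gt3 by (auto simp: \<sigma>_def)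
    have c\<rho>: "0 < cos \<rho>" using \<rho> by (intro cos_gt_zero_pi) auto
    have "cos (\<sigma> / 2) < cos 0" using \<sigma> by (intro cos_monotone_0_pi) auto
    then have gap: "0 < 1 - cos (\<sigma> / 2)" by simp
    \<comment> \<open>The midpoint inequality gives \<open>cos \<rho> * (1 - cos (\<sigma> / 2)) \<le> 2 * h\<close>
      for two points at distance at least \<open>\<sigma>\<close>, which fails when \<open>h\<close> is a quarter of the left side.\<close>
    define h where "h = cos \<rho> * (1 - cos (\<sigma> / 2)) / 4"
    have h: "0 < h" using c\<rho> gap by (simp add: h_def)
    obtain d where d: "0 < d" "\<And>y. y \<in> near_all K I d \<Longrightarrow> \<rho> - h \<le> dist u y"
      using low[OF h] by blast
    obtain e0 where e0: "0 < e0" "\<And>y y'. y \<in> near_all K I e0 \<Longrightarrow> y' \<in> near_all K I e0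
      \<Longrightarrow> mid y y' \<in> near_all K I d"
      using mid_in_near_all[OF d(1), where 'i = 'i] K by metis
    define e where "e = min e0 h"
    have "0 < e" using e0 h by (simp add: e_def)
    moreover have "dist y y' < \<tau>"
      if y: "y \<in> near_all K I e" "y' \<in> near_all K I e"
        and dy: "dist u y \<le> \<rho> + e" "dist u y' \<le> \<rho> + e" for y y'
    proof (rule ccontr)
      assume "\<not> dist y y' < \<tau>"
      then have far: "\<sigma> \<le> dist y y'" using \<sigma> by simp
      define l where "l = dist y y'"
      have "mid y y' \<in> near_all K I d"
        using e0(2) y near_all_mono[of e e0 K I] by (auto simp: e_def)
      from d(2)[OF this] have "\<rho> - h \<le> dist u (mid y y')" .
      have cosle: "cos t \<le> cos \<rho> + h" if "\<rho> - h \<le> t" "t \<le> pi" for t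
      proof (cases "\<rho> \<le> t")
        case True
        then show ?thesis using cos_monotone_0_pi_le[of \<rho> t] \<rho> that h by simp
      next
        case False
        then show ?thesis using cos_lipschitz[of t \<rho>] that by simp
      qed
      have cosge: "cos \<rho> - h \<le> cos t" if "0 \<le> t" "t \<le> \<rho> + h" for t
      proof (cases "t \<le> \<rho>")
        case True
        then show ?thesis using cos_monotone_0_pi_le[of t \<rho>] \<rho> that h by simp
      next
        case False
        then show ?thesis using cos_lipschitz[of t \<rho>] that by simp
      qed
      have "cos \<rho> - h \<le> cos (dist u y)" "cos \<rho> - h \<le> cos (dist u y')"
        using dy by (auto intro!: cosge simp: e_def)
      then have "2 * (cos \<rho> - h) \<le> cos (dist y u) + cos (dist y' u)"
        by (simp add: dist_commute)
      also have "\<dots> \<le> 2 * cos (l / 2) * cos (dist (mid y y') u)"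
        using cos_dist_mid unfolding l_def .
      also have "\<dots> \<le> 2 * cos (\<sigma> / 2) * (cos \<rho> + h)"
      proof (intro mult_mono)
        show "cos (l / 2) \<le> cos (\<sigma> / 2)"
          using far \<sigma> small[of y y'] by (intro cos_monotone_0_pi_le) (auto simp: l_def)
        show "cos (dist (mid y y') u) \<le> cos \<rho> + h"
          using cosle[of "dist u (mid y y')"] \<open>\<rho> - h \<le> _\<close> small[of u "mid y y'"] pi_gt_zero
          by (simp add: dist_commute)
        show "0 \<le> cos (l / 2)"
          using small[of y y'] zero_le_dist[of y y'] pi_gt_zero unfolding l_def
          by (intro cos_ge_zero) linarith+
        show "0 \<le> 2 * cos (\<sigma> / 2)" using \<sigma> by (auto intro!: cos_ge_zero)
      qed (use cos_dist_pos[of "mid y y'" u] in auto)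
      also have "\<dots> \<le> 2 * (cos (\<sigma> / 2) * cos \<rho> + h)"
        using h mult_right_mono[of "cos (\<sigma> / 2)" 1 h] by (simp add: algebra_simps)
      finally have "cos \<rho> * (1 - cos (\<sigma> / 2)) \<le> 2 * h" by (simp add: algebra_simps)
      moreover have "cos \<rho> * (1 - cos (\<sigma> / 2)) = 4 * h" by (simp add: h_def)
      ultimately show False using h by linarith
    qed
    ultimately show ?thesis by blast
  qed
  define \<epsilon> where "\<epsilon> n = 1 / real (Suc n)" for n
  have \<epsilon>: "0 < \<epsilon> n" for n by (simp add: \<epsilon>_def)
  have \<epsilon>0: "\<epsilon> \<longlonglongrightarrow> 0"
    unfolding \<epsilon>_def using LIMSEQ_inverse_real_of_nat by (simp add: divide_inverse)
  have "\<forall>n. \<exists>y. y \<in> near_all K I (\<epsilon> n) \<and> dist u y < \<rho> + \<epsilon> n" using high \<epsilon> by blast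
  then obtain y where y: "\<And>n. y n \<in> near_all K I (\<epsilon> n)" "\<And>n. dist u (y n) < \<rho> + \<epsilon> n" by metis
  have "Cauchy y"
  proof (rule metric_CauchyI)
    fix \<tau> :: real assume "0 < \<tau>"
    then obtain e where e: "0 < e" "\<And>z z'. z \<in> near_all K I e \<Longrightarrow> z' \<in> near_all K I e \<Longrightarrow>
      dist u z \<le> \<rho> + e \<Longrightarrow> dist u z' \<le> \<rho> + e \<Longrightarrow> dist z z' < \<tau>"
      using close by blast
    obtain N where N: "\<And>n. n \<ge> N \<Longrightarrow> \<epsilon> n < e"
      using order_tendstoD(2)[OF \<epsilon>0 e(1)] unfolding eventually_sequentially by blast
    have "dist (y m) (y n) < \<tau>" if "m \<ge> N" "n \<ge> N" for m n
      using y[of m] y[of n] N[OF that(1)] N[OF that(2)]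
        near_all_mono[of "\<epsilon> m" e K I] near_all_mono[of "\<epsilon> n" e K I]
      by (intro e(2)) auto
    then show "\<exists>N. \<forall>m\<ge>N. \<forall>n\<ge>N. dist (y m) (y n) < \<tau>" by blast
  qed
  then obtain q where q: "y \<longlonglongrightarrow> q" using convergent_eq_Cauchy by blast
  have qK: "q \<in> (\<Inter>i\<in>I. K i)"
  proof
    fix i assume i: "i \<in> I"
    have "\<forall>n. \<exists>z. z \<in> K i \<and> dist (y n) z \<le> \<epsilon> n" using y(1) i unfolding near_all_def by blast
    then obtain z where z: "\<And>n. z n \<in> K i" "\<And>n. dist (y n) (z n) \<le> \<epsilon> n" by metis
    have bound: "dist (z n) q \<le> \<epsilon> n + dist (y n) q" for n
      using z(2)[of n] dist_triangle3[of "z n" q "y n"] by linarith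
    have "(\<lambda>n. \<epsilon> n + dist (y n) q) \<longlonglongrightarrow> 0"
      using tendsto_add[OF \<epsilon>0 tendsto_dist_iff[THEN iffD1, OF q]] by simp
    then have "(\<lambda>n. dist (z n) q) \<longlonglongrightarrow> 0"
      by (rule tendsto_sandwich[OF _ _ tendsto_const, rotated 2]) (use bound in auto)
    then have "z \<longlonglongrightarrow> q" by (rule tendsto_dist_iff[THEN iffD2])
    then show "q \<in> K i" using K[OF i] z(1) closed_sequentially by blast
  qed
  have "dist u q \<le> \<rho>"
  proof (rule LIMSEQ_le)
    show "(\<lambda>n. dist u (y n)) \<longlonglongrightarrow> dist u q" by (intro tendsto_intros q)
    show "(\<lambda>n. \<rho> + \<epsilon> n) \<longlonglongrightarrow> \<rho>" using tendsto_add[OF tendsto_const \<epsilon>0] by simp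
  qed (use y(2) less_imp_le in blast)
  then have "dist u q = \<rho>" using \<rho>_le[OF qK] by simp
  then show thesis using that qK \<rho>_le low by simp
qed

section \<open>Metric projections\<close>

lemma nearest_point_unique:
  fixes K :: "'a set"
  assumes "geo_convex K" "p \<in> K" "q \<in> K"
    and p: "\<And>y. y \<in> K \<Longrightarrow> dist x p \<le> dist x y" and q: "\<And>y. y \<in> K \<Longrightarrow> dist x q \<le> dist x y"
  shows "p = q"
proof (rule ccontr)
  assume "p \<noteq> q"
  then have l: "0 < dist p q" by simp
  define m where "m = mid p q"
  have "m \<in> K" unfolding m_def by (rule geo_comb_in_convex) (use assms in auto)
  have "cos (dist x m) \<le> cos (dist x p)" "cos (dist x m) \<le> cos (dist x q)"
    using p q \<open>m \<in> K\<close> dist_less_pi[of x m] by (auto intro!: cos_monotone_0_pi_le)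
  then have "2 * cos (dist x m) \<le> 2 * cos (dist p q / 2) * cos (dist x m)"
    using cos_dist_mid[of p x q] by (simp add: m_def dist_commute)
  then have "1 \<le> cos (dist p q / 2)" using cos_dist_pos[of x m] by simp
  moreover have "cos (dist p q / 2) < cos 0"
    using l dist_less_pi[of p q] by (intro cos_monotone_0_pi) linarith+
  ultimately show False by simp
qed

lemma metric_proj_eqI:
  fixes K :: "'a set"
  assumes K: "geo_convex K" and q: "q \<in> K" "\<And>y. y \<in> K \<Longrightarrow> dist x q \<le> dist x y"
  shows "metric_proj K x = q"
  unfolding metric_proj_def
proof (rule the_equality)
  have bdd: "bdd_below ((\<lambda>y. dist x y) ` K)" by (intro bdd_belowI[of _ 0]) auto
  show "q \<in> K \<and> dist x q = (INF y\<in>K. dist x y)"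
    using q by (auto intro!: antisym cINF_greatest cINF_lower[OF bdd])
  fix p assume p: "p \<in> K \<and> dist x p = (INF y\<in>K. dist x y)"
  then have "dist x p \<le> dist x y" if "y \<in> K" for y
    using cINF_lower[OF bdd that] by simp
  then show "p = q" using nearest_point_unique[OF K] p q by blast
qed

lemma
  fixes K :: "'a set"
  assumes "closed K" "geo_convex K" "K \<noteq> {}"
  shows metric_proj_in: "metric_proj K x \<in> K"
    and metric_proj_le: "y \<in> K \<Longrightarrow> dist x (metric_proj K x) \<le> dist x y"
proof -
  obtain q where q: "q \<in> K" "\<And>p. p \<in> K \<Longrightarrow> dist x q \<le> dist x p"
    by (rule nearest_point_of_Inter[of "{()}" "\<lambda>_. K" x]) (use assms in auto)
  have "metric_proj K x = q" by (rule metric_proj_eqI[OF assms(2) q])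
  then show "metric_proj K x \<in> K" "y \<in> K \<Longrightarrow> dist x (metric_proj K x) \<le> dist x y"
    using q by auto
qed

text \<open>
  The spherical Pythagorean inequality: the angle at the nearest point \<open>q\<close> is at least a right
  angle.  Moving from \<open>q\<close> towards \<open>p\<close> stays in \<open>K\<close>, so it cannot decrease the distance to \<open>x\<close>;
  inserting this into the comparison inequality, dividing by the common factor \<open>2 * sin (t * l / 2)\<close>
  and letting \<open>t\<close> tend to \<open>0\<close> gives the claim.
\<close>

lemma cos_dist_metric_proj:
  fixes K :: "'a set"
  assumes K: "closed K" "geo_convex K" and p: "p \<in> K"
  shows "cos (dist x p) \<le> cos (dist x (metric_proj K x)) * cos (dist p (metric_proj K x))"
proof -
  define q l where "q = metric_proj K x" and "l = dist p q"
  have ne: "K \<noteq> {}" using p by blast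
  note q = metric_proj_in[OF K ne, of x] metric_proj_le[OF K ne, of _ x]
  show ?thesis
  proof (cases "l = 0")
    case True
    then show ?thesis unfolding q_def l_def by auto
  next
    case False
    then have l: "0 < l" "l < pi / 2" using small by (auto simp: l_def)
    have step: "cos (dist x p) * cos (t * l / 2) \<le> cos (dist x q) * cos (l - t * l / 2)"
      if t: "0 < t" "t < 1" for t
    proof -
      have tl: "0 < t * l" "t * l < l" using t l by auto
      have "geo_comb t p q \<in> K"
        using q(1) p t K(2) by (intro geo_comb_in_convex) (auto simp: q_def)
      then have "cos (dist x (geo_comb t p q)) \<le> cos (dist x q)"
        using q(2) dist_less_pi[of x "geo_comb t p q"] by (auto intro!: cos_monotone_0_pi_le simp: q_def)
      moreover have "0 \<le> sin l" using l by (simp add: sin_ge_zero)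
      ultimately have "cos (dist x (geo_comb t p q)) * sin l \<le> cos (dist x q) * sin l"
        by (rule mult_right_mono)
      then have "cos (dist x p) * sin (t * l) + cos (dist x q) * sin ((1 - t) * l)
          \<le> cos (dist x q) * sin l"
        using cos_dist_geo_comb[of t p x q] t by (simp add: dist_commute l_def)
      then have "cos (dist x p) * sin (t * l) \<le> cos (dist x q) * (sin l - sin ((1 - t) * l))"
        by (simp add: algebra_simps)
      also have "sin l - sin ((1 - t) * l) = 2 * sin (t * l / 2) * cos (l - t * l / 2)"
        unfolding sin_diff_sin by (intro arg_cong2[where f = "(*)"] arg_cong[where f = cos]
            arg_cong[where f = sin] refl) (simp_all add: field_simps)
      also have "sin (t * l) = 2 * sin (t * l / 2) * cos (t * l / 2)"
        using sin_double[of "t * l / 2"] by simp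
      finally have "sin (t * l / 2) * (cos (dist x p) * cos (t * l / 2))
          \<le> sin (t * l / 2) * (cos (dist x q) * cos (l - t * l / 2))"
        by (simp add: algebra_simps)
      moreover have "0 < sin (t * l / 2)" using tl l by (intro sin_gt_zero) linarith+
      ultimately show ?thesis by simp
    qed
    have "cos (dist x p) * cos (0 * l / 2) \<le> cos (dist x q) * cos (l - 0 * l / 2)"
    proof (rule tendsto_le[of "at_right 0"])
      show "((\<lambda>t. cos (dist x q) * cos (l - t * l / 2)) \<longlongrightarrow> cos (dist x q) * cos (l - 0 * l / 2))
          (at_right 0)"
        and "((\<lambda>t. cos (dist x p) * cos (t * l / 2)) \<longlongrightarrow> cos (dist x p) * cos (0 * l / 2))
          (at_right 0)"
        by (auto intro!: tendsto_eq_intros)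
      show "\<forall>\<^sub>F t in at_right 0.
          cos (dist x p) * cos (t * l / 2) \<le> cos (dist x q) * cos (l - t * l / 2)"
        using eventually_at_right_less[of 0] eventually_at_right_real[of 0 "1::real"] step
        by (auto elim!: eventually_mono)
    qed simp
    then show ?thesis by (simp add: q_def l_def)
  qed
qed

lemma metric_proj_quasinonexpansive:
  fixes K :: "'a set"
  assumes "closed K" "geo_convex K" "p \<in> K"
  shows "cos (dist x p) \<le> cos (dist (metric_proj K x) p)"
proof -
  have "cos (dist x (metric_proj K x)) * cos (dist p (metric_proj K x))
      \<le> 1 * cos (dist p (metric_proj K x))"
    by (intro mult_right_mono) (simp_all add: cos_dist_pos less_imp_le)
  then show ?thesis using cos_dist_metric_proj[OF assms, of x] by (simp add: dist_commute)
qed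

lemma cos_dist_geo_comb_ge_min:
  fixes x y w :: 'a
  assumes t: "0 \<le> t" "t \<le> 1" and c: "0 \<le> c" "c \<le> cos (dist x w)" "c \<le> cos (dist y w)"
  shows "c \<le> cos (dist (geo_comb t x y) w)"
proof (cases "x = y")
  case True
  then have "geo_comb t x y = x" using dist_left_geo_comb[OF t, of x x] by simp
  then show ?thesis using c by simp
next
  case False
  define l where "l = dist x y"
  have l: "0 < l" "l < pi" using False dist_less_pi[of x y] by (auto simp: l_def)
  have s: "0 < sin l" using l by (simp add: sin_gt_zero)
  have tl: "0 \<le> t * l" "t * l \<le> l" "0 \<le> (1 - t) * l" "(1 - t) * l \<le> l"
    using t l by (auto simp: mult_left_le_one_le)
  have nn: "0 \<le> sin (t * l)" "0 \<le> sin ((1 - t) * l)"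
    using tl l by (intro sin_ge_zero; linarith)+
  have "c * sin l = c * (t * sin l) + c * ((1 - t) * sin l)" by (simp add: algebra_simps)
  also have "\<dots> \<le> c * sin (t * l) + c * sin ((1 - t) * l)"
    using c t l sin_concave_scale[of t l] sin_concave_scale[of "1 - t" l]
    by (intro add_mono mult_left_mono) auto
  also have "\<dots> \<le> cos (dist x w) * sin (t * l) + cos (dist y w) * sin ((1 - t) * l)"
    using nn c by (intro add_mono mult_right_mono) auto
  also have "\<dots> \<le> cos (dist (geo_comb t x y) w) * sin l"
    using cos_dist_geo_comb[OF t] by (simp add: l_def)
  finally show ?thesis using s by simp
qed

text \<open>
  Strict convexity, made quantitative: if \<open>v\<close> is no farther from \<open>p\<close> than \<open>x\<close> is, then a genuine
  mixture of \<open>v\<close> and \<open>x\<close> is closer to \<open>p\<close> by an amount controlled by \<open>dist v x\<close>.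
  It follows from \<open>sin (t * L) + sin ((1 - t) * L) = 2 * sin (L / 2) * cos ((1 / 2 - t) * L)\<close> and
  \<open>sin L = 2 * sin (L / 2) * cos (L / 2)\<close>.
\<close>

lemma geo_comb_gain:
  fixes v x p :: 'a
  assumes a: "0 < a" "a < 1 / 2" and t: "a \<le> t" "t \<le> 1 - a"
    and v: "cos (dist x p) \<le> cos (dist v p)"
  shows "cos (dist x p) * (cos ((1 / 2 - a) * dist v x) - cos (dist v x / 2))
    \<le> cos (dist (geo_comb t v x) p) - cos (dist x p)"
proof (cases "v = x")
  case True
  then have "geo_comb t v x = x" using dist_left_geo_comb[of t x x] a t by simp
  then show ?thesis using True by simp
next
  case False
  define L c c' where "L = dist v x" and "c = cos (dist x p)"
    and "c' = cos (dist (geo_comb t v x) p)"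
  have L: "0 < L" "L < pi / 2" using False small by (auto simp: L_def)
  have s: "0 < sin (L / 2)" using L by (intro sin_gt_zero) auto
  have c: "0 < c" using cos_dist_pos by (simp add: c_def)
  have "0 \<le> t * L" "t * L \<le> 1 * L" using L a t by (auto intro!: mult_right_mono)
  then have st: "0 \<le> sin (t * L)" using L pi_gt_zero by (intro sin_ge_zero) linarith+
  have "cos ((1 / 2 - a) * L) \<le> cos \<bar>(1 / 2 - t) * L\<bar>"
  proof (rule cos_monotone_0_pi_le)
    have "\<bar>1 / 2 - t\<bar> * L \<le> (1 / 2 - a) * L" using a t L by (intro mult_right_mono) auto
    then show "\<bar>(1 / 2 - t) * L\<bar> \<le> (1 / 2 - a) * L" using L by (simp add: abs_mult)
    have "(1 / 2 - a) * L \<le> 1 * L" using a L by (intro mult_right_mono) auto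
    then show "(1 / 2 - a) * L \<le> pi" using L by linarith
  qed simp
  then have "c * cos ((1 / 2 - a) * L) * (2 * sin (L / 2)) \<le> c * cos ((1 / 2 - t) * L) * (2 * sin (L / 2))"
    using s c by (intro mult_right_mono mult_left_mono) auto
  also have "\<dots> = c * (sin (t * L) + sin ((1 - t) * L))"
  proof -
    have *: "(t * L + (1 - t) * L) / 2 = L / 2" "(t * L - (1 - t) * L) / 2 = - ((1 / 2 - t) * L)"
      by (simp_all add: field_simps)
    show ?thesis unfolding sin_plus_sin * by simp
  qed
  also have "\<dots> = c * sin (t * L) + c * sin ((1 - t) * L)" by (simp add: algebra_simps)
  also have "\<dots> \<le> cos (dist v p) * sin (t * L) + c * sin ((1 - t) * L)"
    using v st by (intro add_right_mono mult_right_mono) (auto simp: c_def)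
  also have "\<dots> \<le> c' * sin L"
    using cos_dist_geo_comb[of t v p x] a t by (simp add: L_def c_def c'_def)
  also have "\<dots> = c' * cos (L / 2) * (2 * sin (L / 2))"
    using sin_double[of "L / 2"] by simp
  finally have "c * cos ((1 / 2 - a) * L) \<le> c' * cos (L / 2)" using s by simp
  moreover have "(c' - c) * cos (L / 2) \<le> (c' - c) * 1"
    using cos_dist_geo_comb_ge_min[of t c v p x] v c a t
    by (intro mult_left_mono) (auto simp: c_def c'_def)
  ultimately show ?thesis unfolding L_def c_def c'_def by (simp add: algebra_simps)
qed

end

section \<open>Mappings composed of projections\<close>

lemma cos_half_gap_pos:
  fixes a L :: real
  assumes "0 < a" "a < 1 / 2" "0 < L" "L \<le> pi"
  shows "cos (L / 2) < cos ((1 / 2 - a) * L)"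
proof (rule cos_monotone_0_pi)
  have "(1 / 2 - a) * L < (1 / 2) * L" using assms by (intro mult_strict_right_mono) auto
  then show "(1 / 2 - a) * L < L / 2" by simp
qed (use assms in auto)

text \<open>
  The lower bound for the gain of a mixture increases with the distance of the end points, since it
  is twice a product of two sines with arguments in the first quadrant.  So a small gain forces a
  small distance.
\<close>

lemma cos_half_gap_mono:
  fixes a \<mu> L :: real
  assumes a: "0 < a" "a < 1 / 2" and L: "0 < \<mu>" "\<mu> \<le> L" "L \<le> pi / 2"
  shows "cos ((1 / 2 - a) * \<mu>) - cos (\<mu> / 2) \<le> cos ((1 / 2 - a) * L) - cos (L / 2)"
proof -
  have eq: "cos ((1 / 2 - a) * s) - cos (s / 2) = 2 * (sin ((1 - a) * s / 2) * sin (a * s / 2))" for s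
  proof -
    have *: "((1 / 2 - a) * s + s / 2) / 2 = (1 - a) * s / 2" "(s / 2 - (1 / 2 - a) * s) / 2 = a * s / 2"
      by (simp_all add: field_simps)
    show ?thesis unfolding cos_diff_cos * by simp
  qed
  have sin_le: "0 \<le> sin (b * \<mu> / 2) \<and> sin (b * \<mu> / 2) \<le> sin (b * L / 2)" if b: "0 < b" "b < 1" for b
  proof -
    have "b * \<mu> \<le> b * L" "b * L \<le> 1 * L" using b L by (auto intro!: mult_left_mono mult_right_mono)
    moreover have "0 < b * \<mu>" using b L by simp
    ultimately have "0 \<le> b * \<mu> / 2" "b * \<mu> / 2 \<le> b * L / 2" "b * L / 2 \<le> pi / 2" "0 \<le> pi"
      using L pi_gt_zero by linarith+
    then show ?thesis by (auto intro!: sin_ge_zero sin_monotone_2pi_le)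
  qed
  show ?thesis
    unfolding eq using sin_le[of "1 - a"] sin_le[of a] a
    by (intro mult_left_mono mult_mono) auto
qed

context small_CAT1
begin

abbreviation W_proj :: "(nat \<Rightarrow> 'a set) \<Rightarrow> (nat \<Rightarrow> real) \<Rightarrow> nat \<Rightarrow> 'a \<Rightarrow> 'a" where
  "W_proj K \<equiv> W_mapping (\<lambda>i. metric_proj (K i))"

lemma W_mapping_quasinonexpansive:
  assumes "\<And>i. i \<in> {1..k} \<Longrightarrow> closed (K i) \<and> geo_convex (K i) \<and> p \<in> K i"
    and "\<And>i. i \<in> {1..k} \<Longrightarrow> 0 \<le> \<alpha> i \<and> \<alpha> i \<le> 1"
  shows "cos (dist x p) \<le> cos (dist (W_proj K \<alpha> k x) p)"
  using assms
proof (induction k)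
  case (Suc k)
  have "cos (dist x p) \<le> cos (dist (W_proj K \<alpha> k x) p)"
    using Suc by simp
  also have "\<dots> \<le> cos (dist (metric_proj (K (Suc k)) (W_proj K \<alpha> k x)) p)"
    using Suc.prems(1)[of "Suc k"] by (intro metric_proj_quasinonexpansive) auto
  finally show ?case
    using Suc.prems(2)[of "Suc k"] cos_dist_pos[of x p]
    by (auto intro!: cos_dist_geo_comb_ge_min)
qed simp

text \<open>
  If \<open>x\<close> is hardly moved towards \<open>p\<close> by the \<open>W\<close>-mapping, then \<open>x\<close> is nearly in each \<open>K i\<close> and
  nearly fixed, uniformly in the weights and in \<open>x\<close> as long as \<open>x\<close> stays away from distance
  \<open>pi / 2\<close> to \<open>p\<close>.  In the last stage \<open>x\<close> is mixed with a point \<open>v\<close> of \<open>K k\<close> that is at least as close to \<open>p\<close>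
  as \<open>x\<close>; a small gain makes \<open>dist v x\<close> small.  So \<open>x\<close> is near \<open>K k\<close>, and
  since the preceding stage is no closer to \<open>p\<close> than \<open>v\<close>, its own gain is small as well, and the
  argument repeats.
\<close>

lemma W_mapping_gap:
  fixes K :: "nat \<Rightarrow> 'a set"
  assumes K: "\<And>i. i \<in> {1..k} \<Longrightarrow> closed (K i) \<and> geo_convex (K i) \<and> p \<in> K i"
    and a: "0 < a" "a < 1 / 2" and \<kappa>: "0 < \<kappa>" and h: "0 < h"
  shows "\<exists>d>0. \<forall>\<alpha> x. (\<forall>i\<in>{1..k}. \<alpha> i \<in> {a..1 - a}) \<longrightarrow> \<kappa> \<le> cos (dist x p) \<longrightarrow>
    cos (dist (W_proj K \<alpha> k x) p) - cos (dist x p) \<le> d \<longrightarrow>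
    dist (W_proj K \<alpha> k x) x \<le> h \<and> x \<in> near_all K {1..k} h"
  using K h
proof (induction k arbitrary: h)
  case 0
  then show ?case by (auto simp: near_all_def intro!: exI[of _ 1])
next
  case (Suc k)
  have "\<exists>d>0. \<forall>\<alpha> x. (\<forall>i\<in>{1..k}. \<alpha> i \<in> {a..1 - a}) \<longrightarrow> \<kappa> \<le> cos (dist x p) \<longrightarrow>
    cos (dist (W_proj K \<alpha> k x) p) - cos (dist x p) \<le> d \<longrightarrow>
    dist (W_proj K \<alpha> k x) x \<le> h \<and> x \<in> near_all K {1..k} h"
    by (rule Suc.IH) (use Suc.prems in auto)
  then obtain d' where d': "0 < d'" "\<And>\<alpha> x. (\<forall>i\<in>{1..k}. \<alpha> i \<in> {a..1 - a}) \<Longrightarrow>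
      \<kappa> \<le> cos (dist x p) \<Longrightarrow> cos (dist (W_proj K \<alpha> k x) p) - cos (dist x p) \<le> d' \<Longrightarrow>
      x \<in> near_all K {1..k} h"
    by blast
  define \<mu> where "\<mu> = Min {h, d', 1}"
  have \<mu>: "0 < \<mu>" "\<mu> \<le> h" "\<mu> \<le> d'" "\<mu> \<le> pi"
    using d' Suc.prems(2) pi_gt3 by (auto simp: \<mu>_def)
  define d where "d = \<kappa> * (cos ((1 / 2 - a) * \<mu>) - cos (\<mu> / 2)) / 2"
  have d: "0 < d" using cos_half_gap_pos[OF a \<mu>(1,4)] \<kappa> by (simp add: d_def)
  show ?case
  proof (rule exI[of _ d], rule conjI[OF d], intro allI impI)
    fix \<alpha> :: "nat \<Rightarrow> real" and x
    assume \<alpha>: "\<forall>i\<in>{1..Suc k}. \<alpha> i \<in> {a..1 - a}" and x: "\<kappa> \<le> cos (dist x p)"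
      and g: "cos (dist (W_proj K \<alpha> (Suc k) x) p) - cos (dist x p) \<le> d"
    define y v t where "y = W_proj K \<alpha> k x" and "v = metric_proj (K (Suc k)) y" and "t = \<alpha> (Suc k)"
    have z: "W_proj K \<alpha> (Suc k) x = geo_comb t v x" by (simp add: y_def v_def t_def)
    have t: "a \<le> t" "t \<le> 1 - a" using \<alpha> by (auto simp: t_def)
    have K': "closed (K (Suc k))" "geo_convex (K (Suc k))" "p \<in> K (Suc k)"
      using Suc.prems(1) by auto
    have vK: "v \<in> K (Suc k)"
      unfolding v_def using K' by (intro metric_proj_in) auto
    have xy: "cos (dist x p) \<le> cos (dist y p)"
      unfolding y_def
    proof (rule W_mapping_quasinonexpansive)
      show "0 \<le> \<alpha> i \<and> \<alpha> i \<le> 1" if "i \<in> {1..k}" for i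
        using \<alpha>[rule_format, of i] a that by auto
    qed (use Suc.prems(1) in auto)
    have yv: "cos (dist y p) \<le> cos (dist v p)"
      unfolding v_def using K' by (intro metric_proj_quasinonexpansive) auto
    have "dist v x < \<mu>"
    proof (rule ccontr)
      assume "\<not> dist v x < \<mu>"
      then have le: "cos ((1 / 2 - a) * \<mu>) - cos (\<mu> / 2)
          \<le> cos ((1 / 2 - a) * dist v x) - cos (dist v x / 2)"
        using small[of v x] \<mu> by (intro cos_half_gap_mono a) auto
      have pos: "0 < cos ((1 / 2 - a) * \<mu>) - cos (\<mu> / 2)"
        using cos_half_gap_pos[OF a \<mu>(1,4)] by simp
      have "2 * d = \<kappa> * (cos ((1 / 2 - a) * \<mu>) - cos (\<mu> / 2))" by (simp add: d_def)
      also have "\<dots> \<le> cos (dist x p) * (cos ((1 / 2 - a) * dist v x) - cos (dist v x / 2))"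
        using le pos x \<kappa> by (intro mult_mono) auto
      also have "\<dots> \<le> d"
        using geo_comb_gain[OF a t, of x p v] xy yv g unfolding z by linarith
      finally show False using d by simp
    qed
    then have vx: "dist v x \<le> h" "dist v x \<le> d'" using \<mu> by auto
    have "dist (W_proj K \<alpha> (Suc k) x) x = t * dist v x"
      unfolding z using a t by (intro dist_geo_comb_right) auto
    also have "\<dots> \<le> 1 * dist v x" using a t by (intro mult_right_mono) auto
    finally have "dist (W_proj K \<alpha> (Suc k) x) x \<le> h" using vx by simp
    moreover have "x \<in> near_all K {1..Suc k} h"
    proof -
      have "cos (dist v p) \<le> cos (dist x p) + dist v x"
        using cos_lipschitz[of "dist v p" "dist x p"] abs_dist_diff_le[of v p x]
        by (simp add: dist_commute)
      then have "cos (dist y p) - cos (dist x p) \<le> d'" using yv vx by linarith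
      then have "x \<in> near_all K {1..k} h" using d'(2)[of \<alpha> x] \<alpha> x by (simp add: y_def)
      moreover have "\<exists>q\<in>K (Suc k). dist x q \<le> h" using vK vx by (auto simp: dist_commute)
      ultimately show ?thesis by (auto simp: near_all_def atLeastAtMostSuc_conv)
    qed
    ultimately show "dist (W_proj K \<alpha> (Suc k) x) x \<le> h \<and> x \<in> near_all K {1..Suc k} h" by blast
  qed
qed

section \<open>The Halpern step\<close>

text \<open>
  One step of the iteration, as an inequality for \<open>1 - cos (dist _ p)\<close>.  For \<open>D > 0\<close> the weight of
  the old value is \<open>1 - g = sin ((1 - b) * D) / sin D\<close>, and the term with \<open>u\<close> has weight
  \<open>sin (b * D) / sin D\<close>; for \<open>D = 0\<close> the weights are \<open>1 - b\<close> and \<open>b\<close>.  Both \<open>g\<close> and that weight contain the factor \<open>2 * sin (b * D / 2) / sin D\<close>;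
  cancelling it leads to the condition on \<open>e\<close>, which for small \<open>b\<close> says roughly
  \<open>1 - e \<le> cos (dist u p) / cos D\<close>.
\<close>

lemma halpern_step:
  fixes u w p :: 'a
  defines "D \<equiv> dist u w"
  assumes b: "0 < b" "b < 1"
  obtains g where "b * cos (D - b * D / 2) \<le> g" "g \<le> b"
    "\<And>e. (1 - e) * cos (D - b * D / 2) \<le> cos (b * D / 2) * cos (dist u p) \<Longrightarrow>
      1 - cos (dist (geo_comb b u w) p) \<le> (1 - g) * (1 - cos (dist w p)) + g * e"
proof (cases "u = w")
  case True
  then have D: "D = 0" "geo_comb b u w = w"
    using dist_left_geo_comb[of b w w] b by (auto simp: D_def)
  show ?thesis
  proof (rule that[of b])
    fix e assume "(1 - e) * cos (D - b * D / 2) \<le> cos (b * D / 2) * cos (dist u p)"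
    then have "1 - cos (dist w p) \<le> e" using D True by simp
    then have "b * (1 - cos (dist w p)) \<le> b * e" using b by (intro mult_left_mono) auto
    then show "1 - cos (dist (geo_comb b u w) p) \<le> (1 - b) * (1 - cos (dist w p)) + b * e"
      unfolding D(2) by (simp add: algebra_simps)
  qed (use b D in auto)
next
  case False
  then have D: "0 < D" "D < pi / 2" using small by (auto simp: D_def)
  have s: "0 < sin D" using D by (intro sin_gt_zero) auto
  have bD: "0 < b * D" "b * D < D" using b D by auto
  define S where "S = 2 * sin (b * D / 2) / sin D"
  have S: "b \<le> S"
  proof -
    have "b * sin (D / 2) \<le> sin (b * (D / 2))"
      using b D by (intro sin_concave_scale) auto
    moreover have "sin D \<le> 2 * sin (D / 2)"
    proof -
      have "sin (D / 2) * cos (D / 2) \<le> sin (D / 2) * 1"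
        using D by (intro mult_left_mono sin_ge_zero) auto
      then show ?thesis using sin_double[of "D / 2"] by simp
    qed
    then have "b * sin D \<le> b * (2 * sin (D / 2))" using b by (intro mult_left_mono) auto
    ultimately have "b * sin D \<le> 2 * sin (b * D / 2)" by simp
    then show ?thesis using s by (simp add: S_def pos_le_divide_eq)
  qed
  define g where "g = 1 - sin ((1 - b) * D) / sin D"
  have g_eq: "g = S * cos (D - b * D / 2)"
  proof -
    have "sin D - sin ((1 - b) * D) = 2 * sin (b * D / 2) * cos (D - b * D / 2)"
      unfolding sin_diff_sin by (intro arg_cong2[where f = "(*)"] arg_cong[where f = cos]
          arg_cong[where f = sin] refl) (simp_all add: field_simps)
    then show ?thesis using s by (simp add: g_def S_def field_simps)
  qed
  have cpos: "0 \<le> cos (D - b * D / 2)" using bD D by (intro cos_ge_zero) linarith+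
  show ?thesis
  proof (rule that[of g])
    show "b * cos (D - b * D / 2) \<le> g"
      unfolding g_eq using S cpos by (rule mult_right_mono)
    have "(1 - b) * sin D \<le> sin ((1 - b) * D)" using b D by (intro sin_concave_scale) auto
    then have "1 - b \<le> sin ((1 - b) * D) / sin D" using s by (simp add: pos_le_divide_eq)
    then show "g \<le> b" by (simp add: g_def)
    fix e assume "(1 - e) * cos (D - b * D / 2) \<le> cos (b * D / 2) * cos (dist u p)"
    then have "S * ((1 - e) * cos (D - b * D / 2)) \<le> S * (cos (b * D / 2) * cos (dist u p))"
      using S b by (intro mult_left_mono) auto
    also have "\<dots> = cos (dist u p) * (sin (b * D) / sin D)"
      using sin_double[of "b * D / 2"] by (simp add: S_def field_simps)
    finally have "(1 - e) * g \<le> cos (dist u p) * (sin (b * D) / sin D)"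
      by (simp add: g_eq algebra_simps)
    moreover have "cos (dist u p) * (sin (b * D) / sin D) + cos (dist w p) * (1 - g)
        \<le> cos (dist (geo_comb b u w) p)"
      using cos_dist_geo_comb[of b u p w] b s
      by (simp add: g_def D_def[symmetric] field_simps)
    ultimately show "1 - cos (dist (geo_comb b u w) p) \<le> (1 - g) * (1 - cos (dist w p)) + g * e"
      by (simp add: algebra_simps)
  qed
qed

end

text \<open>
  The condition of the preceding step lemma holds as soon as \<open>D\<close> is not much smaller than
  \<open>\<delta> = dist u p\<close> and \<open>b\<close> is small.  Replacing \<open>D - b * D / 2\<close> by \<open>\<delta>\<close> costs at most \<open>2 * \<theta>\<close> and
  replacing \<open>cos (b * D / 2)\<close> by \<open>1\<close> costs at most \<open>\<theta>\<close>, which the slack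
  \<open>e * cos \<delta> = 4 * \<theta>\<close> absorbs.
\<close>

lemma halpern_cos_bound:
  fixes D b \<delta> \<theta> e :: real
  assumes D: "0 \<le> D" "D < pi / 2" and b: "0 < b" "b < 1" "b \<le> \<theta>"
    and \<delta>: "0 \<le> \<delta>" "\<delta> < pi / 2" "\<delta> - \<theta> \<le> D"
    and e: "0 < e" "e < 1" and \<theta>: "\<theta> = e * cos \<delta> / 4"
  shows "(1 - e) * cos (D - b * D / 2) \<le> cos (b * D / 2) * cos \<delta>"
proof -
  have c: "0 < cos \<delta>" "cos \<delta> \<le> 1" using \<delta> by (auto intro!: cos_gt_zero_pi)
  have D2: "D < 2" using D pi_less_4 by linarith
  have bD: "0 \<le> b * D" "b * D \<le> b * 2" "b * D \<le> D"
    using b D D2 by (auto intro: mult_left_mono mult_left_le_one_le)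
  define A where "A = D - b * D / 2"
  have A: "0 \<le> A" "A \<le> D" "\<delta> - 2 * \<theta> \<le> A"
    unfolding A_def using bD b \<delta> D by linarith+
  have "cos A \<le> cos \<delta> + 2 * \<theta>"
  proof (cases "\<delta> \<le> A")
    case True
    then have "cos A \<le> cos \<delta>" using A D \<delta> by (intro cos_monotone_0_pi_le) auto
    then show ?thesis using b by linarith
  next
    case False
    then show ?thesis using cos_lipschitz[of A \<delta>] A by linarith
  qed
  then have "(1 - e) * cos A \<le> (1 - e) * (cos \<delta> + 2 * \<theta>)" using e by (intro mult_left_mono) auto
  also have "\<dots> \<le> (1 - \<theta>) * cos \<delta>"
  proof -
    define t where "t = e * \<theta>"
    have le: "\<theta> * cos \<delta> \<le> \<theta>" "0 \<le> t" "0 < \<theta>"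
      using c b e by (auto simp: t_def mult_left_le)
    have "(1 - e) * (cos \<delta> + 2 * \<theta>) = cos \<delta> - 2 * \<theta> - 2 * t"
      using \<theta> by (simp add: t_def algebra_simps)
    also have "\<dots> \<le> cos \<delta> - \<theta> * cos \<delta>" using le by linarith
    finally show ?thesis by (simp add: algebra_simps)
  qed
  also have "\<dots> \<le> cos (b * D / 2) * cos \<delta>"
  proof (rule mult_right_mono)
    show "1 - \<theta> \<le> cos (b * D / 2)" using cos_lipschitz[of 0 "b * D / 2"] bD b unfolding cos_zero by linarith
  qed (use c in simp)
  finally show ?thesis by (simp add: A_def)
qed

text \<open>
  Even when \<open>D\<close> comes close to \<open>pi / 2\<close>, the weight \<open>g\<close> of a step is at least of order \<open>b\<^sup>2\<close>.
  This is what makes divergence of the sum of squares sufficient.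
\<close>

lemma cos_reduced_ge:
  fixes D b :: real
  assumes "0 \<le> D" "D < pi / 2" "0 < b" "b < 1"
  shows "b / 2 \<le> cos (D - b * D / 2)"
proof -
  have "sin (pi / 6) \<le> sin (pi / 4)" by (rule sin_monotone_2pi_le) auto
  then have "b * (1 / 2) \<le> b * sin (pi / 4)" using assms by (intro mult_left_mono) (auto simp: sin_30)
  also have "\<dots> \<le> sin (b * (pi / 4))" using assms by (intro sin_concave_scale) auto
  also have "\<dots> = cos (pi / 2 - b * (pi / 4))" by (simp add: cos_diff)
  also have "\<dots> \<le> cos (D - b * D / 2)"
  proof (rule cos_monotone_0_pi_le)
    have "b * D \<le> 1 * D" using assms by (intro mult_right_mono) auto
    then show "0 \<le> D - b * D / 2" using assms by linarith
    have "D * (1 - b / 2) \<le> pi / 2 * (1 - b / 2)" using assms by (intro mult_right_mono) auto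
    then show "D - b * D / 2 \<le> pi / 2 - b * (pi / 4)" by (simp add: algebra_simps)
    have "0 \<le> b * (pi / 4)" using assms by simp
    then show "pi / 2 - b * (pi / 4) \<le> pi" using pi_gt_zero by linarith
  qed
  finally show ?thesis by simp
qed

section \<open>Convergence\<close>

lemma sum_shift_at_top:
  fixes f :: "nat \<Rightarrow> real"
  assumes "filterlim (\<lambda>M. \<Sum>n=1..M. f n) at_top sequentially"
  shows "filterlim (\<lambda>k. \<Sum>i<k. f (Suc N + i)) at_top sequentially"
proof -
  have eq: "(\<Sum>n=1..N + k. f n) = (\<Sum>n=1..N. f n) + (\<Sum>i<k. f (Suc N + i))" for k
    by (induction k) auto
  have "filterlim (\<lambda>k. - (\<Sum>n=1..N. f n) + (\<Sum>n=1..N + k. f n)) at_top sequentially"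
    by (intro filterlim_tendsto_add_at_top[OF tendsto_const] filterlim_compose[OF assms]
        filterlim_subseq) (simp add: strict_mono_def)
  then show ?thesis unfolding eq by simp
qed

text \<open>
  The positive part of \<open>s n - e\<close> is multiplied in each step by at most
  \<open>1 - g n \<le> exp (- (c * f n))\<close>, and the product of these factors tends to \<open>0\<close>.
\<close>

lemma eventually_below_if_contracting:
  fixes s f g :: "nat \<Rightarrow> real"
  assumes div: "filterlim (\<lambda>M. \<Sum>n=1..M. f n) at_top sequentially" and c: "0 < c"
    and g: "\<And>n. n > N \<Longrightarrow> c * f n \<le> g n" "\<And>n. n > N \<Longrightarrow> g n \<le> 1"
    and s: "\<And>n. n > N \<Longrightarrow> s (Suc n) - e \<le> (1 - g n) * (s n - e)"
    and h: "0 < h"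
  shows "\<forall>\<^sub>F n in sequentially. s n < e + h"
proof -
  define m where "m n = max 0 (s n - e)" for n
  define F where "F k = (\<Sum>i<k. f (Suc N + i))" for k
  have step: "m (Suc n) \<le> exp (- (c * f n)) * m n" if n: "n > N" for n
  proof -
    have "(1 - g n) * (s n - e) \<le> (1 - g n) * m n"
      using g(2)[OF n] by (intro mult_left_mono) (auto simp: m_def)
    then have "m (Suc n) \<le> (1 - g n) * m n"
      using s[OF n] g(2)[OF n] by (auto simp: m_def)
    also have "\<dots> \<le> exp (- (c * f n)) * m n"
    proof (rule mult_right_mono)
      have "1 - g n \<le> 1 + - (c * f n)" using g(1)[OF n] by simp
      also have "\<dots> \<le> exp (- (c * f n))" by (rule exp_ge_add_one_self)
      finally show "1 - g n \<le> exp (- (c * f n))" .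
    qed (simp add: m_def)
    finally show ?thesis .
  qed
  have bound: "m (k + Suc N) \<le> exp (- (c * F k)) * m (Suc N)" for k
  proof (induction k)
    case (Suc k)
    have "m (Suc k + Suc N) \<le> exp (- (c * f (Suc N + k))) * m (k + Suc N)"
      using step[of "k + Suc N"] by (simp add: add.commute)
    also have "\<dots> \<le> exp (- (c * f (Suc N + k))) * (exp (- (c * F k)) * m (Suc N))"
      using Suc by (intro mult_left_mono) auto
    also have "\<dots> = exp (- (c * F (Suc k))) * m (Suc N)"
      by (simp add: F_def algebra_simps flip: exp_add mult.assoc)
    finally show ?case .
  qed (simp add: F_def)
  have "filterlim F at_top sequentially" unfolding F_def by (rule sum_shift_at_top[OF div])
  then have "filterlim (\<lambda>k. c * F k) at_top sequentially"
    by (rule filterlim_tendsto_pos_mult_at_top[OF tendsto_const c])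
  then have "((\<lambda>k. exp (- (c * F k))) \<longlongrightarrow> 0) sequentially"
    by (intro filterlim_compose[OF exp_at_bot]) (simp add: filterlim_uminus_at_bot)
  then have "((\<lambda>k. exp (- (c * F k)) * m (Suc N)) \<longlongrightarrow> 0) sequentially"
    by (rule tendsto_mult_left_zero)
  then have "\<forall>\<^sub>F k in sequentially. exp (- (c * F k)) * m (Suc N) < h"
    using h by (rule order_tendstoD(2))
  then have "\<forall>\<^sub>F k in sequentially. s (k + Suc N) < e + h"
  proof (rule eventually_mono)
    fix k assume "exp (- (c * F k)) * m (Suc N) < h"
    then have "m (k + Suc N) < h" using bound[of k] by linarith
    then show "s (k + Suc N) < e + h" by (simp add: m_def)
  qed
  then show ?thesis by (subst (asm) eventually_sequentially_seg)
qed

lemma geo_convex_INT: "(\<And>i. i \<in> I \<Longrightarrow> geo_convex (K i)) \<Longrightarrow> geo_convex (\<Inter>i\<in>I. K i)"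
  by (simp add: geo_convex_def INT_greatest)

theorem theorem4p2:
  fixes C :: "nat \<Rightarrow> 'a::complete_space set"
    and r :: nat
    and a :: real
    and \<alpha> :: "nat \<Rightarrow> nat \<Rightarrow> real"
    and W :: "nat \<Rightarrow> 'a \<Rightarrow> 'a"
    and \<beta> :: "nat \<Rightarrow> real"
    and u :: 'a
    and x :: "nat \<Rightarrow> 'a"
  assumes "CAT1_space TYPE('a)"
    and "\<forall>v v' :: 'a. dist v v' < pi / 2"
    and "r \<ge> 1"
    and "\<forall>i\<in>{1..r}. closed (C i) \<and> geo_convex (C i)"
    and "(\<Inter>i\<in>{1..r}. C i) \<noteq> {}"
    and "0 < a" and "a < 1 / 2"
    and "\<forall>n\<ge>1. \<forall>i\<in>{1..r}. \<alpha> n i \<in> {a..1 - a}"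
    and "\<forall>n\<ge>1. W n = W_mapping (\<lambda>i. metric_proj (C i)) (\<alpha> n) r"
    and "\<forall>n\<ge>1. 0 < \<beta> n \<and> \<beta> n < 1"
    and "\<beta> \<longlonglongrightarrow> 0"
    and "filterlim (\<lambda>N. \<Sum>n=1..N. \<beta> n) at_top sequentially"
    and "\<forall>n\<ge>1. x (Suc n) = geo_comb (\<beta> n) u (W n (x n))"
    and "(SUP (v, v')\<in>(UNIV :: ('a \<times> 'a) set). dist v v') < pi / 2 \<or>
         (dist u (metric_proj (\<Inter>i\<in>{1..r}. C i) u) < pi / 4 \<and>
          dist u (metric_proj (\<Inter>i\<in>{1..r}. C i) u) +
            dist (x 1) (metric_proj (\<Inter>i\<in>{1..r}. C i) u) < pi / 2) \<or>
         filterlim (\<lambda>N. \<Sum>n=1..N. (\<beta> n)\<^sup>2) at_top sequentially"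
  shows "x \<longlonglongrightarrow> metric_proj (\<Inter>i\<in>{1..r}. C i) u"
proof -
  interpret small_CAT1 "TYPE('a)"
    using assms(1,2) by unfold_locales auto
  note cvx = assms(4) and a = assms(6,7) and \<alpha> = assms(8) and W = assms(9) and \<beta> = assms(10)
    and x_Suc = assms(13)
  define p where "p = metric_proj (\<Inter>i\<in>{1..r}. C i) u"
  obtain q where q: "q \<in> (\<Inter>i\<in>{1..r}. C i)" "\<And>y. y \<in> (\<Inter>i\<in>{1..r}. C i) \<Longrightarrow> dist u q \<le> dist u y"
    and low: "\<And>h. 0 < h \<Longrightarrow> \<exists>e>0. \<forall>y\<in>near_all C {1..r} e. dist u q - h \<le> dist u y"
    by (rule nearest_point_of_Inter[of "{1..r}" C u]) (use cvx assms(5) in auto)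
  have "p = q"
    unfolding p_def using cvx by (intro metric_proj_eqI geo_convex_INT q) auto
  then have Cp: "closed (C i) \<and> geo_convex (C i) \<and> p \<in> C i" if "i \<in> {1..r}" for i
    using that cvx q(1) by blast
  define w where "w n = W n (x n)" for n
  define s where "s n = 1 - cos (dist (x n) p)" for n
  define D where "D n = dist u (w n)" for n
  have D: "0 \<le> D n" "D n < pi / 2" for n using small by (auto simp: D_def)
  have \<beta>D: "0 \<le> \<beta> n * D n" "\<beta> n * D n \<le> D n" if "n \<ge> 1" for n
    using \<beta> that D by (auto simp: less_imp_le intro!: mult_left_le_one_le)
  have xw: "cos (dist (x n) p) \<le> cos (dist (w n) p)" if n: "n \<ge> 1" for n
  proof -
    have w: "w n = W_proj C (\<alpha> n) r (x n)" using W n by (simp add: w_def)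
    show ?thesis unfolding w
    proof (rule W_mapping_quasinonexpansive)
      show "0 \<le> \<alpha> n i \<and> \<alpha> n i \<le> 1" if "i \<in> {1..r}" for i
        using \<alpha>[rule_format, of n i] n a that by auto
    qed (rule Cp)
  qed
  \<comment> \<open>No iterate is farther from \<open>p\<close> than the farther of \<open>u\<close> and \<open>x 1\<close>, so the distances to \<open>p\<close> stay
    away from \<open>pi / 2\<close>.\<close>
  define R where "R = max (dist u p) (dist (x 1) p)"
  have R: "0 \<le> R" "R < pi / 2"
    using small[of u p] small[of "x 1" p] unfolding R_def by (auto simp only: le_max_iff_disj max_less_iff_conj zero_le_dist)
  have R_pos: "0 < cos R" using R by (intro cos_gt_zero_pi) auto
  have xR: "cos R \<le> cos (dist (x n) p)" if "n \<ge> 1" for n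
    using that
  proof (induction n rule: nat_induct_at_least)
    case base
    show ?case using R by (intro cos_monotone_0_pi_le) (auto simp: R_def)
  next
    case (Suc n)
    have "cos R \<le> cos (dist u p)" using R by (intro cos_monotone_0_pi_le) (auto simp: R_def)
    moreover have "cos R \<le> cos (dist (w n) p)" using Suc xw by force
    ultimately have "cos R \<le> cos (dist (geo_comb (\<beta> n) u (w n)) p)"
      using \<beta> Suc.hyps R_pos by (intro cos_dist_geo_comb_ge_min) (auto simp: less_imp_le)
    then show ?case using x_Suc Suc.hyps by (simp add: w_def)
  qed
  \<comment> \<open>Each of the three alternatives makes the sum of the contraction weights diverge: the first two
    bound \<open>D n\<close> away from \<open>pi / 2\<close>, so that the weights are of order \<open>\<beta> n\<close>; in the third one they
    are at least of order \<open>(\<beta> n)\<^sup>2\<close>.\<close>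
  obtain c f where c: "0 < c" and f: "filterlim (\<lambda>M. \<Sum>n=1..M. f n) at_top sequentially"
    and cf: "\<And>n. n \<ge> 1 \<Longrightarrow> c * f n \<le> \<beta> n * cos (D n - \<beta> n * D n / 2)"
  proof -
    note diverges = that
    have bounded: thesis if M: "M < pi / 2" "\<And>n. n \<ge> 1 \<Longrightarrow> D n \<le> M" for M
    proof (rule diverges[of "cos M" \<beta>])
      have M0: "0 \<le> M" using M(2)[of 1] D(1)[of 1] by simp
      then show "0 < cos M" using M(1) by (intro cos_gt_zero_pi) auto
      show "cos M * \<beta> n \<le> \<beta> n * cos (D n - \<beta> n * D n / 2)" if n: "n \<ge> 1" for n
      proof -
        have "cos M \<le> cos (D n - \<beta> n * D n / 2)"
          using M(1) M(2)[OF n] \<beta>D[OF n] M0 by (intro cos_monotone_0_pi_le) linarith+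
        then show ?thesis using \<beta> n by (simp add: mult.commute mult_left_mono less_imp_le)
      qed
    qed (rule assms(12))
    from assms(14) show thesis
    proof (elim disjE conjE)
      assume sup: "(SUP (v, v')\<in>(UNIV :: ('a \<times> 'a) set). dist v v') < pi / 2"
      have "bdd_above ((\<lambda>(v, v'). dist v v') ` (UNIV :: ('a \<times> 'a) set))"
        by (rule bdd_aboveI[of _ "pi / 2"]) (use small less_imp_le in auto)
      then have "dist v v' \<le> (SUP (v, v')\<in>(UNIV :: ('a \<times> 'a) set). dist v v')" for v v' :: 'a
        using cSUP_upper[of "(v, v')" UNIV "\<lambda>(v, v'). dist v v'"] by simp
      then show thesis using bounded[OF sup] by (simp add: D_def)
    next
      assume b: "dist u (metric_proj (\<Inter>i\<in>{1..r}. C i) u) < pi / 4"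
        "dist u (metric_proj (\<Inter>i\<in>{1..r}. C i) u) +
            dist (x 1) (metric_proj (\<Inter>i\<in>{1..r}. C i) u) < pi / 2"
      show thesis
      proof (rule bounded[of "dist u p + R"])
        show "dist u p + R < pi / 2" using b[folded p_def] unfolding R_def by linarith
        show "D n \<le> dist u p + R" if n: "n \<ge> 1" for n
        proof -
          have "cos R \<le> cos (dist (w n) p)" using xR[OF n] xw[OF n] by simp
          then have "dist (w n) p \<le> R"
            using cos_mono_le_eq[of R "dist (w n) p"] R dist_less_pi[of "w n" p] by simp
          then show ?thesis using dist_triangle[of u "w n" p] by (simp add: D_def dist_commute)
        qed
      qed
    next
      assume sq: "filterlim (\<lambda>N. \<Sum>n=1..N. (\<beta> n)\<^sup>2) at_top sequentially"
      have "1 / 2 * (\<beta> n)\<^sup>2 \<le> \<beta> n * cos (D n - \<beta> n * D n / 2)" if n: "n \<ge> 1" for n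
      proof -
        have "\<beta> n * (\<beta> n / 2) \<le> \<beta> n * cos (D n - \<beta> n * D n / 2)"
          using \<beta> n D by (intro mult_left_mono cos_reduced_ge) (auto simp: less_imp_le)
        then show ?thesis by (simp add: power2_eq_square)
      qed
      then show thesis using diverges[of "1 / 2", OF _ sq] by simp
    qed
  qed
  have "\<exists>g. \<forall>n\<ge>1. \<beta> n * cos (D n - \<beta> n * D n / 2) \<le> g n \<and> g n \<le> \<beta> n \<and>
    (\<forall>e. (1 - e) * cos (D n - \<beta> n * D n / 2) \<le> cos (\<beta> n * D n / 2) * cos (dist u p) \<longrightarrow>
      s (Suc n) \<le> (1 - g n) * (1 - cos (dist (w n) p)) + g n * e)" (is "\<exists>g. \<forall>n\<ge>1. ?P n (g n)")
  proof -
    have "\<exists>g. ?P n g" if n: "n \<ge> 1" for n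
      by (rule halpern_step[of "\<beta> n" u "w n" p])
        (use \<beta> n x_Suc in \<open>auto simp: s_def D_def simp flip: w_def\<close>)
    then show ?thesis by metis
  qed
  then obtain g where g_low: "\<And>n. n \<ge> 1 \<Longrightarrow> \<beta> n * cos (D n - \<beta> n * D n / 2) \<le> g n"
    and g_up: "\<And>n. n \<ge> 1 \<Longrightarrow> g n \<le> \<beta> n"
    and step: "\<And>n e. n \<ge> 1 \<Longrightarrow>
      (1 - e) * cos (D n - \<beta> n * D n / 2) \<le> cos (\<beta> n * D n / 2) * cos (dist u p) \<Longrightarrow>
      s (Suc n) \<le> (1 - g n) * (1 - cos (dist (w n) p)) + g n * e"
    by blast
  have g0: "0 \<le> g n" if n: "n \<ge> 1" for n
  proof -
    have "0 \<le> \<beta> n * cos (D n - \<beta> n * D n / 2)"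
      using cos_reduced_ge[OF D, of "\<beta> n" n] \<beta> n by (intro mult_nonneg_nonneg) force+
    then show ?thesis using g_low[OF n] by linarith
  qed
  have small_s: "\<forall>\<^sub>F n in sequentially. s n < e + e" if e: "0 < e" "e < 1" for e
  proof -
    define \<theta> where "\<theta> = e * cos (dist u p) / 4"
    have \<theta>: "0 < \<theta>" using e cos_dist_pos by (simp add: \<theta>_def)
    obtain h where h: "0 < h" "\<And>y. y \<in> near_all C {1..r} h \<Longrightarrow> dist u p - \<theta> \<le> dist u y"
      using low[OF \<theta>] \<open>p = q\<close> by blast
    have "0 < h / 2" using h by simp
    from W_mapping_gap[of r C p a "cos R" "h / 2", OF Cp a R_pos this]
    obtain d where d: "0 < d" and gap: "\<And>\<alpha>' y. (\<And>i. i \<in> {1..r} \<Longrightarrow> \<alpha>' i \<in> {a..1 - a}) \<Longrightarrow>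
      cos R \<le> cos (dist y p) \<Longrightarrow> cos (dist (W_proj C \<alpha>' r y) p) - cos (dist y p) \<le> d \<Longrightarrow>
      dist (W_proj C \<alpha>' r y) y \<le> h / 2 \<and> y \<in> near_all C {1..r} (h / 2)"
      by blast
    \<comment> \<open>With \<open>g n \<le> 1 / 2\<close> and \<open>g n \<le> d / 2\<close> one has \<open>g n \<le> (1 - g n) * d\<close>.\<close>
    have "0 < min \<theta> (min (d / 2) (1 / 2))" using \<theta> d by simp
    from order_tendstoD(2)[OF assms(11) this]
    obtain N where N: "\<And>n. n \<ge> N \<Longrightarrow> \<beta> n < \<theta> \<and> \<beta> n < d / 2 \<and> \<beta> n < 1 / 2"
      unfolding eventually_sequentially by auto
    show ?thesis
    proof (rule eventually_below_if_contracting[OF f c, of N g])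
      fix n assume nN: "n > N"
      then have n: "n \<ge> 1" by simp
      note \<beta>n = N[OF less_imp_le[OF nN]]
      show "c * f n \<le> g n" using cf[OF n] g_low[OF n] by simp
      have g1: "g n \<le> 1 / 2" "g n \<le> d / 2" using g_up[OF n] \<beta>n by auto
      then show "g n \<le> 1" by simp
      define A where "A = 1 - cos (dist (w n) p)"
      have As: "A \<le> s n" using xw[OF n] by (simp add: A_def s_def)
      have "s (Suc n) \<le> (1 - g n) * s n + g n * e"
      \<comment> \<open>Either \<open>W n\<close> gains little; then \<open>w n\<close> is nearly in all sets, thus \<open>D n\<close> is almost
        \<open>dist u p\<close> or larger, and the step lemma applies with \<open>e\<close>.  Or it gains more than \<open>d\<close>,
        which outweighs the trivial loss \<open>g n\<close> of the step lemma with \<open>1\<close> for \<open>e\<close>.\<close>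
      proof (cases "cos (dist (w n) p) - cos (dist (x n) p) \<le> d")
        case True
        have w_eq: "w n = W_proj C (\<alpha> n) r (x n)" using W n by (simp add: w_def)
        have wx: "dist (w n) (x n) \<le> h / 2" "x n \<in> near_all C {1..r} (h / 2)"
          using gap[of "\<alpha> n" "x n"] \<alpha> n xR[OF n] True unfolding w_eq by blast+
        have "w n \<in> near_all C {1..r} h"
          unfolding near_all_def
        proof (intro CollectI ballI)
          fix i assume "i \<in> {1..r}"
          then obtain z where "z \<in> C i" "dist (x n) z \<le> h / 2"
            using wx(2) unfolding near_all_def by blast
          moreover from this have "dist (w n) z \<le> h"
            using wx(1) dist_triangle[of "w n" z "x n"] by linarith
          ultimately show "\<exists>z\<in>C i. dist (w n) z \<le> h" by blast
        qed
        then have "dist u p - \<theta> \<le> D n" using h(2) by (simp add: D_def)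
        then have "s (Suc n) \<le> (1 - g n) * A + g n * e"
          unfolding A_def using \<beta> n \<beta>n D small e \<theta>_def
          by (intro step halpern_cos_bound[where \<theta> = \<theta>]) (auto simp: less_imp_le)
        also have "\<dots> \<le> (1 - g n) * s n + g n * e"
          using As g1 by (intro add_right_mono mult_left_mono) auto
        finally show ?thesis .
      next
        case False
        then have Ad: "A \<le> s n - d" by (simp add: A_def s_def)
        have "0 \<le> cos (\<beta> n * D n / 2)"
          using D[of n] \<beta>D[OF n] by (intro cos_ge_zero) linarith+
        then have "s (Suc n) \<le> (1 - g n) * A + g n * 1"
          unfolding A_def using cos_dist_pos[of u p] by (intro step n) auto
        also have "\<dots> \<le> (1 - g n) * (s n - d) + g n * 1"
          using Ad g1 by (intro add_right_mono mult_left_mono) auto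
        also have "\<dots> \<le> (1 - g n) * s n + g n * e"
        proof -
          have "1 / 2 * d \<le> (1 - g n) * d" using g1 d by (intro mult_right_mono) auto
          moreover have "0 \<le> g n * e" using g0[OF n] e by simp
          ultimately show ?thesis using g1 by (simp add: algebra_simps)
        qed
        finally show ?thesis .
      qed
      then show "s (Suc n) - e \<le> (1 - g n) * (s n - e)" by (simp add: algebra_simps)
    qed (use e in simp)
  qed
  have "x \<longlonglongrightarrow> p"
  proof (rule metric_LIMSEQ_I)
    fix \<tau> :: real assume "0 < \<tau>"
    define \<sigma> where "\<sigma> = min \<tau> 1"
    have \<sigma>: "0 < \<sigma>" "\<sigma> \<le> pi" "\<sigma> \<le> \<tau>" using \<open>0 < \<tau>\<close> pi_gt3 by (auto simp: \<sigma>_def)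
    have "cos \<sigma> < cos 0" using \<sigma> by (intro cos_monotone_0_pi) auto
    moreover have "0 < cos \<sigma>" using \<sigma> pi_gt3 by (intro cos_gt_zero_pi) (auto simp: \<sigma>_def)
    ultimately have "\<forall>\<^sub>F n in sequentially. s n < (1 - cos \<sigma>) / 2 + (1 - cos \<sigma>) / 2"
      by (intro small_s) auto
    then have "\<forall>\<^sub>F n in sequentially. dist (x n) p < \<tau>"
    proof (rule eventually_mono)
      fix n assume "s n < (1 - cos \<sigma>) / 2 + (1 - cos \<sigma>) / 2"
      then have "dist (x n) p < \<sigma>" by (intro dist_less_if_cos \<sigma>) (auto simp: s_def)
      then show "dist (x n) p < \<tau>" using \<sigma> by simp
    qed
    then show "\<exists>N. \<forall>n\<ge>N. dist (x n) p < \<tau>" unfolding eventually_sequentially .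
  qed
  then show ?thesis unfolding p_def .
qed

end
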